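(* Let $v$ be an $\alpha$-flow, with $\alpha$ a nontrivial continuous 1-cocycle, on a compact metric space $(X,d)$. If $v$ is not a gradient-like flow, then for any sequence $\{s_i\}$ of small positive numbers tending to zero as $i\to\infty$, and for any $M>0$ and $T>0$, there is for each $s_i$ a $(\mathcal U(s_i),T)$-chain $\tilde\gamma_i$ such that $$\left|\int_{\tilde\gamma_i}\alpha\right|\ge M .$$
   Context: A flow $v$ is a continuous $\mathbb R$-action $(x,t)\mapsto x\cdot t$ on $X$; its fixed point set $S_v$ is assumed to have finitely many connected components. $[x,x\cdot t]$ denotes a trajectory segment. The flow is gradient-like if there is a continuous function $g:X\to\mathbb R$ (a Lyapunov function) which is strictly decreasing along every nonconstant trajectory. Cocycles. A continuous 1-cocycle (in bounded Alexander–Spanier cohomology) is a bounded function $\alpha:X\times X\to\mathbb R$ for which there is $r>0$ such that for each open ball $B$ of radius $r$ there is a bounded continuous function $\beta_B$ on $\bar B$ with $\alpha(x,y)=\beta_B(y)-\beta_B(x)$ for $x,y\in\bar B$. It is trivial (a coboundary) if there is a continuous $g:X\to\mathbb R$ with $\alpha(x,y)=g(y)-g(x)$ for all $(x,y)$ in a neighborhood of the diagonal, and nontrivial otherwise; $[\alpha]$ is its cohomology class. For a curve $\gamma:[a,b]\to X$, $\int_\gamma\alpha=\sum_i\alpha(\gamma(\tau_i),\gamma(\tau_{i+1}))$ for any sufficiently fine subdivision of $[a,b]$. Chains. $\mathcal U(s)$ denotes a covering of $X$ by balls of radius $s$. A $(\mathcal U(s),T)$-chain from $x$ to $x'$ is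 a sequence $\{x=x_1,\dots,x_{k+1}=x'\mid t_1,\dots,t_k\}$ with $t_i\ge T$ such that each pair $(x_i\cdot t_i,x_{i+1})$ lies in a common ball of $\mathcal U(s)$. For such a chain, $\int_{\tilde\gamma}\alpha=\sum_i\big(\int_{[x_i,x_i\cdot t_i]}\alpha+\alpha(x_i\cdot t_i,x_{i+1})\big)$. $\alpha$-flow. Let $\mathcal A$ be an isolated invariant set of $v$ containing $S_v$, with finitely many connected components $A_1,\dots,A_n$. For $A_i$ with isolating neighborhood $U_i$, closed neighborhood $V_i\subset U_i$ of $A_i$ and small $r>0$, the flow neighborhood $A_i(r)=A_i(V_i,r)$ is the compact set of points $x\in V_i$ whose forward or backward orbit reaches the closed $r$-neighborhood of $A_i$ without leaving $V_i$. The maximal trajectory pieces of $v$ in $X\setminus\bigcup_iA_i(r)$ are divided into $\Gamma_1^{\mathcal A}(r)$ (time domain $(a,b)$ bounded), $\Gamma_2^{\mathcal A}(r)$ (time domain $(a,+\infty)$ or $(-\infty,b)$), and $\Gamma_3^{\mathcal A}(r)$ (time domain $\mathbb R$). If $[\alpha]$ restricts to $0$ on an open set, so $\alpha=\delta\beta$ there, i.e. $\alpha(x,y)=\beta(y)-\beta(x)$ locally with $\beta$ continuous, put $I_\alpha(x,y)=\beta(y)-\beta(x)$. The flow $v$ is a generalized $\alpha$-flow with respect to $\mathcal A$ if there are a small $r>0$, $T_0>0$, $\rho>0$ and $0\le\lambda<1$ such that: (1) $[\alpha]|_{A_i}=0$ and $\max_{(x,y)\in A_i(r)\times A_i(r)}|I_\alpha(x,y)|\le\lambda\rho$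 for $1\le i\le n$; (2) $\int_\gamma\alpha\ge\rho$ for every $\gamma\in\Gamma^{\mathcal A}_1(r)$; (3) $\int_{\gamma(T_0)}\alpha\ge\rho$ for every sub-trajectory $\gamma(T_0)$ of time length $T_0$ of any $\gamma\in\Gamma_2^{\mathcal A}(r)\cup\Gamma_3^{\mathcal A}(r)$. It is an $\alpha$-flow if moreover $\mathcal A$ consists only of points.
   Formalization: In the definition of an α-flow, the flow neighborhoods A_i(r) of different components are required to be pairwise disjoint (as with disjoint isolating neighborhoods); with overlapping V_i the claim can fail. *)

theory Defs
  imports "HOL-Analysis.Analysis"
begin

section \<open>Flows\<close>

definition is_flow :: "('a::metric_space \<Rightarrow> real \<Rightarrow> 'a) \<Rightarrow> bool" where
  "is_flow v \<longleftrightarrow>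
     continuous_on UNIV (\<lambda>(x, t). v x t) \<and>
     (\<forall>x. v x 0 = x) \<and>
     (\<forall>x s t. v (v x s) t = v x (s + t))"

definition fixed_points :: "('a \<Rightarrow> real \<Rightarrow> 'a) \<Rightarrow> 'a set" where
  "fixed_points v = {x. \<forall>t. v x t = x}"

definition gradient_like :: "('a::metric_space \<Rightarrow> real \<Rightarrow> 'a) \<Rightarrow> bool" where
  "gradient_like v \<longleftrightarrow>
     (\<exists>g :: 'a \<Rightarrow> real. continuous_on UNIV g \<and>
        (\<forall>x. x \<notin> fixed_points v \<longrightarrow> (\<forall>s t. s < t \<longrightarrow> g (v x t) < g (v x s))))"

definition isolating_nbhd :: "('a::metric_space \<Rightarrow> real \<Rightarrow> 'a) \<Rightarrow> 'a set \<Rightarrow> 'a set \<Rightarrow> bool" where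
  "isolating_nbhd v U A \<longleftrightarrow>
     compact U \<and> A \<subseteq> interior U \<and> A = {x. \<forall>t. v x t \<in> U}"
  (* the right-hand side of the equation is the largest invariant subset of U *)

definition isolated_invariant :: "('a::metric_space \<Rightarrow> real \<Rightarrow> 'a) \<Rightarrow> 'a set \<Rightarrow> bool" where
  "isolated_invariant v A \<longleftrightarrow> (\<exists>U. isolating_nbhd v U A)"


section \<open>Cocycles and their integrals\<close>

definition continuous_cocycle :: "('a::metric_space \<Rightarrow> 'a \<Rightarrow> real) \<Rightarrow> bool" where
  "continuous_cocycle \<alpha> \<longleftrightarrow>
     bounded (range (\<lambda>(x, y). \<alpha> x y)) \<and>
     (\<exists>r>0. \<forall>c. \<exists>\<beta>.
        continuous_on (closure (ball c r)) \<beta> \<and>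
        bounded (\<beta> ` closure (ball c r)) \<and>
        (\<forall>x\<in>closure (ball c r). \<forall>y\<in>closure (ball c r). \<alpha> x y = \<beta> y - \<beta> x))"

text \<open>\<open>primitive_on \<alpha> S \<beta>\<close>: on \<open>S\<close> one has \<open>\<alpha> = \<delta>\<beta>\<close> with \<open>\<beta>\<close> continuous. As always for
  Alexander--Spanier cochains, the equation is only required near the diagonal of \<open>S \<times> S\<close>.\<close>

definition primitive_on :: "('a::metric_space \<Rightarrow> 'a \<Rightarrow> real) \<Rightarrow> 'a set \<Rightarrow> ('a \<Rightarrow> real) \<Rightarrow> bool" where
  "primitive_on \<alpha> S \<beta> \<longleftrightarrow>
     continuous_on S \<beta> \<and>
     (\<exists>N. open N \<and> (\<forall>x\<in>S. (x, x) \<in> N) \<and>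
        (\<forall>x\<in>S. \<forall>y\<in>S. (x, y) \<in> N \<longrightarrow> \<alpha> x y = \<beta> y - \<beta> x))"

definition class_zero_on :: "('a::metric_space \<Rightarrow> 'a \<Rightarrow> real) \<Rightarrow> 'a set \<Rightarrow> bool" where
  "class_zero_on \<alpha> S \<longleftrightarrow> (\<exists>\<beta>. primitive_on \<alpha> S \<beta>)"

definition trivial_cocycle :: "('a::metric_space \<Rightarrow> 'a \<Rightarrow> real) \<Rightarrow> bool" where
  "trivial_cocycle \<alpha> \<longleftrightarrow> class_zero_on \<alpha> UNIV"

definition fine_subdivision :: "real \<Rightarrow> real \<Rightarrow> real \<Rightarrow> nat \<Rightarrow> (nat \<Rightarrow> real) \<Rightarrow> bool" where
  "fine_subdivision \<delta> a b m \<tau> \<longleftrightarrow>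
     \<tau> 0 = a \<and> \<tau> m = b \<and> (\<forall>i<m. \<tau> i < \<tau> (Suc i) \<and> \<tau> (Suc i) - \<tau> i < \<delta>)"

text \<open>The common value of the sums over all sufficiently fine subdivisions of \<open>[a, b]\<close>; it exists
  for continuous cocycles and continuous curves.\<close>

definition curve_integral :: "('a \<Rightarrow> 'a \<Rightarrow> real) \<Rightarrow> (real \<Rightarrow> 'a) \<Rightarrow> real \<Rightarrow> real \<Rightarrow> real" where
  "curve_integral \<alpha> \<gamma> a b =
     (THE I. \<exists>\<delta>>0. \<forall>m \<tau>. fine_subdivision \<delta> a b m \<tau> \<longrightarrow>
        (\<Sum>i<m. \<alpha> (\<gamma> (\<tau> i)) (\<gamma> (\<tau> (Suc i)))) = I)"


section \<open>Chains\<close>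

definition ball_covering :: "real \<Rightarrow> 'a::metric_space set set \<Rightarrow> bool" where
  "ball_covering s \<U> \<longleftrightarrow> (\<forall>B\<in>\<U>. \<exists>c. B = ball c s) \<and> \<Union>\<U> = UNIV"

text \<open>The chain \<open>{x 0, \<dots>, x k | t 0, \<dots>, t (k - 1)}\<close> from \<open>x 0\<close> to \<open>x k\<close>, indexed from \<open>0\<close>.\<close>

definition is_chain ::
  "('a \<Rightarrow> real \<Rightarrow> 'a) \<Rightarrow> 'a set set \<Rightarrow> real \<Rightarrow> nat \<Rightarrow> (nat \<Rightarrow> 'a) \<Rightarrow> (nat \<Rightarrow> real) \<Rightarrow> bool" where
  "is_chain v \<U> T k x t \<longleftrightarrow>
     1 \<le> k \<and>
     (\<forall>i<k. T \<le> t i \<and> (\<exists>B\<in>\<U>. v (x i) (t i) \<in> B \<and> x (Suc i) \<in> B))"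

definition chain_integral ::
  "('a \<Rightarrow> 'a \<Rightarrow> real) \<Rightarrow> ('a \<Rightarrow> real \<Rightarrow> 'a) \<Rightarrow> nat \<Rightarrow> (nat \<Rightarrow> 'a) \<Rightarrow> (nat \<Rightarrow> real) \<Rightarrow> real" where
  "chain_integral \<alpha> v k x t =
     (\<Sum>i<k. curve_integral \<alpha> (v (x i)) 0 (t i) + \<alpha> (v (x i) (t i)) (x (Suc i)))"


section \<open>Generalized alpha-flows\<close>

text \<open>The flow neighbourhood \<open>C(V, r)\<close>; the sign of \<open>t\<close> distinguishes forward and backward
  orbits.\<close>

definition flow_nbhd ::
  "('a::metric_space \<Rightarrow> real \<Rightarrow> 'a) \<Rightarrow> 'a set \<Rightarrow> 'a set \<Rightarrow> real \<Rightarrow> 'a set" where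
  "flow_nbhd v C V r =
     {x \<in> V. \<exists>t. infdist (v x t) C \<le> r \<and> (\<forall>\<tau>\<in>closed_segment 0 t. v x \<tau> \<in> V)}"

text \<open>A maximal trajectory piece in the complement of \<open>K\<close> is a pair of a base point \<open>x\<close> and a
  connected component \<open>J\<close> of the set of times at which the trajectory of \<open>x\<close> is outside \<open>K\<close>.\<close>

definition max_pieces :: "('a \<Rightarrow> real \<Rightarrow> 'a) \<Rightarrow> 'a set \<Rightarrow> ('a \<times> real set) set" where
  "max_pieces v K = {(x, J). J \<in> components {t. v x t \<notin> K}}"

definition Gamma1 :: "('a \<Rightarrow> real \<Rightarrow> 'a) \<Rightarrow> 'a set \<Rightarrow> ('a \<times> real set) set" where
  "Gamma1 v K = {(x, J) \<in> max_pieces v K. \<exists>a b. a < b \<and> J = {a<..<b}}"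

definition Gamma2 :: "('a \<Rightarrow> real \<Rightarrow> 'a) \<Rightarrow> 'a set \<Rightarrow> ('a \<times> real set) set" where
  "Gamma2 v K = {(x, J) \<in> max_pieces v K. \<exists>a. J = {a<..} \<or> J = {..<a}}"

definition Gamma3 :: "('a \<Rightarrow> real \<Rightarrow> 'a) \<Rightarrow> 'a set \<Rightarrow> ('a \<times> real set) set" where
  "Gamma3 v K = {(x, J) \<in> max_pieces v K. J = UNIV}"

text \<open>The components of \<open>A\<close> are indexed by themselves, so \<open>U\<close>, \<open>V\<close> and \<open>K\<close> assign to a
  component \<open>C\<close> its isolating neighbourhood, its closed neighbourhood and its flow neighbourhood.
  That \<open>r\<close> is small is used in the form that the flow neighbourhoods of different components are
  disjoint. The primitive \<open>\<beta>\<close> defining \<open>I\<^sub>\<alpha>\<close> lives on an open set \<open>W\<close> around the flow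
  neighbourhood. The integral over a piece with bounded time domain \<open>(a, b)\<close> is taken over
  \<open>[a, b]\<close>, to which the trajectory extends. The constant
  \<open>\<theta>\<close> is the usual \<open>\<lambda>\<close>, which is not available as a variable name.\<close>

definition generalized_alpha_flow ::
  "('a::metric_space \<Rightarrow> real \<Rightarrow> 'a) \<Rightarrow> ('a \<Rightarrow> 'a \<Rightarrow> real) \<Rightarrow> 'a set \<Rightarrow> bool" where
  "generalized_alpha_flow v \<alpha> A \<longleftrightarrow>
     isolated_invariant v A \<and> fixed_points v \<subseteq> A \<and> finite (components A) \<and>
     (\<exists>U V K r T\<^sub>0 \<rho> \<theta>.
        r > 0 \<and> T\<^sub>0 > 0 \<and> \<rho> > 0 \<and> 0 \<le> \<theta> \<and> \<theta> < 1 \<and>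
        (\<forall>C\<in>components A.
           isolating_nbhd v (U C) C \<and>
           closed (V C) \<and> C \<subseteq> interior (V C) \<and> V C \<subseteq> U C \<and>
           K C = flow_nbhd v C (V C) r) \<and>
        disjoint_family_on K (components A) \<and>
        (\<forall>C\<in>components A.
           class_zero_on \<alpha> C \<and>
           (\<exists>W \<beta>. open W \<and> K C \<subseteq> W \<and> primitive_on \<alpha> W \<beta> \<and>
              (\<forall>x\<in>K C. \<forall>y\<in>K C. \<bar>\<beta> y - \<beta> x\<bar> \<le> \<theta> * \<rho>))) \<and>
        (\<forall>x a b. a < b \<longrightarrow> (x, {a<..<b}) \<in> Gamma1 v (\<Union>C\<in>components A. K C) \<longrightarrow>
           curve_integral \<alpha> (v x) a b \<ge> \<rho>) \<and>
        (\<forall>x J c.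
           (x, J) \<in> Gamma2 v (\<Union>C\<in>components A. K C) \<union> Gamma3 v (\<Union>C\<in>components A. K C) \<longrightarrow>
           {c..c + T\<^sub>0} \<subseteq> J \<longrightarrow>
           curve_integral \<alpha> (v x) c (c + T\<^sub>0) \<ge> \<rho>))"

definition alpha_flow ::
  "('a::metric_space \<Rightarrow> real \<Rightarrow> 'a) \<Rightarrow> ('a \<Rightarrow> 'a \<Rightarrow> real) \<Rightarrow> bool" where
  "alpha_flow v \<alpha> \<longleftrightarrow>
     (\<exists>A. generalized_alpha_flow v \<alpha> A \<and> (\<forall>C\<in>components A. \<exists>p. C = {p}))"

end

theory Submission
  imports Defs
begin

text \<open>
  The theorem is proved in contraposed form: if the integrals of \<open>\<alpha>\<close> over the chains of one
  covering are bounded, then the flow is gradient-like. It is enough to look at chains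
  all of whose times are equal to \<open>T\<close> and whose jumps are shorter than a Lebesgue number of
  the covering; these are the chains of the homeomorphism \<open>\<lambda>x. v x T\<close>.

  By a Conley type argument, a flow whose chain recurrent points are all fixed is gradient-like
  (\<open>gradient_like_if_no_chain_recurrence\<close>). Suppose therefore that some point \<open>y\<close> is chain
  recurrent but not fixed. Going \<open>n\<close> times around a closed chain multiplies its integral by \<open>n\<close>,
  so the bound forces the integrals over closed chains to vanish. Hence the integral of \<open>\<alpha>\<close>
  over a chain from \<open>y\<close> to \<open>z\<close> depends only on \<open>z\<close> as long as \<open>z\<close> stays in the chain class of \<open>y\<close>,
  and it defines a continuous primitive \<open>\<beta>\<close> of \<open>\<alpha>\<close> there (\<open>primitive_on_chain_class\<close>). The chain
  class is compact and invariant, so \<open>\<beta>\<close> is bounded and its increments along orbits of the class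
  are integrals of \<open>\<alpha>\<close>.

  This is incompatible with the growth conditions of an \<open>\<alpha>\<close>-flow. Boundedness excludes
  pieces with unbounded time domain, every other piece outside the flow neighbourhoods \<open>K C\<close>
  raises \<open>\<beta>\<close> by at least \<open>\<rho>\<close>, and two points of one \<open>K C\<close> differ by at most \<open>\<theta> \<rho> < \<rho>\<close> in the local
  primitive. Take a point \<open>z\<close> at which \<open>\<beta>\<close> is largest among the points of the chain class in
  the flow neighbourhoods, say \<open>z \<in> K C\<close>. If its orbit leaves \<open>K C\<close>, then the next piece ends in a
  point with a larger value of \<open>\<beta>\<close>. If it stays, then it converges to the fixed point \<open>p\<close> with
  \<open>C = {p}\<close>, so \<open>p\<close> lies in the chain class. Chains from \<open>p\<close> back to \<open>y\<close> have to leave \<open>p\<close>, and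
  a limit of their exit points is a point \<open>w \<noteq> p\<close> of the class whose backward orbit stays in
  \<open>K C\<close> and tends to \<open>p\<close> (\<open>exists_unstable_point_in_chain_class\<close>). The orbit of \<open>w\<close> does leave \<open>K C\<close>,
  and continuity of the primitives at \<open>p\<close> allows the two orbits to be treated as a single passage
  through \<open>K C\<close> (\<open>continue_from_K\<close>). Again the next piece contradicts the choice of \<open>z\<close>.
\<close>

section \<open>Flows on compact spaces\<close>

locale compact_flow =
  fixes v :: "'a::metric_space \<Rightarrow> real \<Rightarrow> 'a"
  assumes compact_UNIV: "compact (UNIV :: 'a set)"
    and flow: "is_flow v"
begin

lemma flow_0 [simp]: "v x 0 = x"
  using flow by (simp add: is_flow_def)

lemma flow_flow [simp]: "v (v x s) t = v x (s + t)"
  using flow by (simp add: is_flow_def)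

lemma flow_tendsto:
  assumes "(f \<longlongrightarrow> x) F" "(g \<longlongrightarrow> t) F"
  shows "((\<lambda>n. v (f n) (g n)) \<longlongrightarrow> v x t) F"
proof -
  have "isCont (\<lambda>(x, t). v x t) (x, t)"
    using flow by (simp add: is_flow_def continuous_on_eq_continuous_at)
  from isCont_tendsto_compose[OF this tendsto_Pair[OF assms]] show ?thesis by simp
qed

lemma continuous_on_flow [continuous_intros]:
  assumes "continuous_on S f" "continuous_on S g"
  shows "continuous_on S (\<lambda>z. v (f z) (g z))"
  using assms by (auto simp: continuous_on_def intro: flow_tendsto)

lemma flow_uniformly_continuous:
  assumes "0 < e"
  obtains d where "0 < d" "\<And>x y. dist x y < d \<Longrightarrow> dist (v x t) (v y t) < e"
proof -
  have "uniformly_continuous_on UNIV (\<lambda>x. v x t)"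
    by (intro compact_uniformly_continuous compact_UNIV continuous_intros)
  then show ?thesis
    using assms that unfolding uniformly_continuous_on_def by (metis UNIV_I dist_commute)
qed

lemma flow_small_time:
  assumes "0 < e"
  obtains d where "0 < d" "\<And>x t. \<bar>t\<bar> < d \<Longrightarrow> dist x (v x t) < e"
proof -
  have "uniformly_continuous_on (UNIV \<times> {-1..1}) (\<lambda>z. v (fst z) (snd z))"
    by (intro compact_uniformly_continuous compact_Times compact_UNIV continuous_intros) auto
  then obtain d where d: "0 < d" "\<And>z z'. z \<in> UNIV \<times> {-1..1} \<Longrightarrow> z' \<in> UNIV \<times> {-1..1} \<Longrightarrow>
      dist z' z < d \<Longrightarrow> dist (v (fst z') (snd z')) (v (fst z) (snd z)) < e"
    using assms unfolding uniformly_continuous_on_def by metis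
  have "dist x (v x t) < e" if "\<bar>t\<bar> < min d 1" for x t
    using d(2)[of "(x, t)" "(x, 0)"] that by (simp add: dist_Pair_Pair abs_le_iff less_imp_le dist_commute)
  then show ?thesis
    using that[of "min d 1"] d(1) by auto
qed

lemma convergent_subsequence:
  fixes f :: "nat \<Rightarrow> 'a"
  obtains l r where "strict_mono (r :: nat \<Rightarrow> nat)" "(\<lambda>n. f (r n)) \<longlonglongrightarrow> l"
proof -
  obtain l r where "strict_mono (r :: nat \<Rightarrow> nat)" "(f \<circ> r) \<longlonglongrightarrow> l"
    using compact_UNIV[THEN compact_imp_seq_compact] by (rule seq_compactE) auto
  with that show ?thesis by (simp add: o_def)
qed

text \<open>Limit points of a forward orbit inherit the closed set that contains the orbit for
  all times, negative ones included, because the times along the sequence tend to infinity.\<close>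

lemma forward_limit_point:
  assumes "closed V" and "\<And>t. 0 \<le> t \<Longrightarrow> v x t \<in> V"
  obtains l r where "strict_mono (r :: nat \<Rightarrow> nat)" "(\<lambda>n. v x (real (r n))) \<longlonglongrightarrow> l"
    "\<And>t. v l t \<in> V"
proof -
  obtain l r where r: "strict_mono (r :: nat \<Rightarrow> nat)" "(\<lambda>n. v x (real (r n))) \<longlonglongrightarrow> l"
    by (rule convergent_subsequence)
  have "v l t \<in> V" for t
  proof (rule Lim_in_closed_set[OF assms(1) _ sequentially_bot])
    show "(\<lambda>n. v (v x (real (r n))) t) \<longlonglongrightarrow> v l t"
      by (intro flow_tendsto r tendsto_const)
    show "\<forall>\<^sub>F n in sequentially. v (v x (real (r n))) t \<in> V"
    proof (rule eventually_sequentiallyI)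
      fix n assume "nat \<lceil>- t\<rceil> \<le> n"
      then have "- t \<le> real (r n)"
        using seq_suble[OF r(1), of n] by linarith
      then show "v (v x (real (r n))) t \<in> V" by (simp add: assms(2))
    qed
  qed
  with r that show ?thesis by blast
qed

text \<open>Statements about backward orbits follow from those about forward orbits.\<close>

lemma reversed: "compact_flow (\<lambda>x t. v x (- t))"
proof
  show "is_flow (\<lambda>x t. v x (- t))"
    unfolding is_flow_def case_prod_unfold by (auto intro!: continuous_intros)
qed (rule compact_UNIV)

end

section \<open>Chains\<close>

locale compact_flow_step = compact_flow +
  fixes T :: real
  assumes T_pos: "0 < T"
begin

text \<open>The nodes of a chain all of whose times are equal to \<open>T\<close>, with jumps shorter than \<open>e\<close>.\<close>

definition jump :: "real \<Rightarrow> 'a \<Rightarrow> 'a \<Rightarrow> bool" where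
  "jump e x z \<longleftrightarrow> dist (v x T) z < e"

abbreviation reach :: "real \<Rightarrow> 'a \<Rightarrow> 'a \<Rightarrow> bool" where
  "reach e \<equiv> (jump e)\<^sup>+\<^sup>+"

definition chains_to :: "'a \<Rightarrow> 'a \<Rightarrow> bool" (infix "\<leadsto>" 50) where
  "x \<leadsto> z \<longleftrightarrow> (\<forall>e>0. reach e x z)"

lemma jump_mono: "jump e x z \<Longrightarrow> e \<le> e' \<Longrightarrow> jump e' x z"
  by (simp add: jump_def)

lemma reach_mono:
  assumes "reach e x z" "e \<le> e'"
  shows "reach e' x z"
  using assms(1)
proof (induction rule: tranclp_induct)
  case (base z)
  with assms(2) show ?case by (intro tranclp.r_into_trancl) (rule jump_mono)
next
  case (step u z)
  from step.IH jump_mono[OF step.hyps(2) assms(2)] show ?case by (rule tranclp.trancl_into_trancl)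
qed

lemma chains_to_trans: "x \<leadsto> y \<Longrightarrow> y \<leadsto> z \<Longrightarrow> x \<leadsto> z"
  unfolding chains_to_def by (meson tranclp_trans)

lemma reach_perturb_end:
  assumes "reach e x z" "dist z z' < e'"
  shows "reach (e + e') x z'"
proof -
  have *: "jump (e + e') u z'" if "jump e u z" for u
    using that assms(2) dist_triangle[of "v u T" z' z] by (simp add: jump_def)
  have "0 \<le> e'"
    using assms(2) zero_le_dist[of z z'] by linarith
  from assms(1) show ?thesis
  proof (cases rule: tranclp.cases)
    case r_into_trancl
    then show ?thesis using * by blast
  next
    case (trancl_into_trancl u)
    with * reach_mono[of e x u "e + e'"] \<open>0 \<le> e'\<close> show ?thesis
      by (meson tranclp.trancl_into_trancl le_add_same_cancel1)
  qed
qed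

text \<open>A small change of the first node is moved by the flow to a small change of the
  first jump, with a modulus that does not depend on the chain.\<close>

lemma reach_perturb_start:
  assumes "0 < e'"
  obtains d where "0 < d" "\<And>e x x' z. dist x x' < d \<Longrightarrow> reach e x z \<Longrightarrow> reach (e + e') x' z"
proof -
  obtain d where d: "0 < d" "\<And>x y. dist x y < d \<Longrightarrow> dist (v x T) (v y T) < e'"
    using flow_uniformly_continuous[OF assms] by metis
  have "reach (e + e') x' z" if "dist x x' < d" "reach e x z" for e x x' z
  proof -
    have *: "jump (e + e') x' u" if "jump e x u" for u
      using d(2)[OF \<open>dist x x' < d\<close>] that dist_triangle[of "v x' T" u "v x T"]
      by (simp add: jump_def dist_commute)
    from that(2) obtain u where u: "jump e x u" "(jump e)\<^sup>*\<^sup>* u z"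
      by (meson tranclpD)
    show ?thesis
      using *[OF u(1)] u(2) reach_mono[of e u z "e + e'"] assms
      by (metis less_add_same_cancel1 less_le_not_le rtranclpD tranclp.simps tranclp_trans)
  qed
  with d(1) that show ?thesis by blast
qed

text \<open>The time-\<open>s\<close> map is uniformly continuous and commutes with the flow, so it carries fine chains
  to fine chains.\<close>

lemma chains_to_flow:
  assumes "x \<leadsto> z"
  shows "v x s \<leadsto> v z s"
  unfolding chains_to_def
proof (intro allI impI)
  fix e :: real assume "0 < e"
  then obtain d where d: "0 < d" "\<And>x y. dist x y < d \<Longrightarrow> dist (v x s) (v y s) < e"
    using flow_uniformly_continuous by metis
  have *: "jump e (v x s) (v z s)" if "jump d x z" for x z
    using d(2)[of "v x T" z] that by (simp add: jump_def add.commute)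
  have "reach d x z" using assms d(1) by (simp add: chains_to_def)
  then show "reach e (v x s) (v z s)"
    by induction (use * tranclp.intros in metis)+
qed

text \<open>All points of the orbit of \<open>z\<close> are chain recurrent by \<open>chains_to_flow\<close>, so the end of a
  closed chain can be moved a short step along the orbit; repeating this reaches every point of the
  orbit, in either time direction.\<close>

lemma chain_recurrent_imp_chains_to_orbit:
  assumes "z \<leadsto> z"
  shows "z \<leadsto> v z t"
  unfolding chains_to_def
proof (intro allI impI)
  fix e :: real assume "0 < e"
  then obtain d where d: "0 < d" "\<And>x t. \<bar>t\<bar> < d \<Longrightarrow> dist x (v x t) < e / 2"
    using flow_small_time[of "e / 2"] by auto
  have *: "reach e z (v z (real n * h))" if "\<bar>h\<bar> < d" for n h
  proof (induction n)
    case 0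
    then show ?case using assms \<open>0 < e\<close> by (simp add: chains_to_def)
  next
    case (Suc n)
    let ?w = "v z (real n * h)"
    have "reach (e / 2) ?w ?w"
      using chains_to_flow[OF assms] \<open>0 < e\<close> by (simp add: chains_to_def)
    \<comment> \<open>End the closed chain through \<open>?w\<close> at the next point of the orbit instead.\<close>
    from reach_perturb_end[OF this d(2)[OF that]] have "reach e ?w (v z (real (Suc n) * h))"
      by (simp add: algebra_simps)
    with Suc show ?case by (rule tranclp_trans)
  qed
  define n where "n = nat \<lceil>\<bar>t\<bar> / d\<rceil> + 1"
  have "0 < real n" by (simp add: n_def)
  moreover have "\<bar>t\<bar> / d < real n" unfolding n_def by linarith
  ultimately have "\<bar>t / real n\<bar> < d" "real n * (t / real n) = t"
    using d(1) by (auto simp: field_simps)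
  with *[of "t / real n" n] show "reach e z (v z t)" by simp
qed

definition chain_class :: "'a \<Rightarrow> 'a set" where
  "chain_class y = {z. y \<leadsto> z \<and> z \<leadsto> y}"

lemma chain_class_flow:
  assumes "z \<in> chain_class y"
  shows "v z t \<in> chain_class y"
proof -
  have z: "z \<leadsto> z" using assms chains_to_trans by (auto simp: chain_class_def)
  have "v z t \<leadsto> z"
    using chain_recurrent_imp_chains_to_orbit[OF chains_to_flow[OF z, of t], of "- t"] by simp
  with chain_recurrent_imp_chains_to_orbit[OF z, of t] assms chains_to_trans show ?thesis
    unfolding chain_class_def by blast
qed

lemma chains_to_limit_end:
  assumes "\<And>e. 0 < e \<Longrightarrow> \<exists>z'. dist z' z < e \<and> reach e x z'"
  shows "x \<leadsto> z"
  unfolding chains_to_def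
proof (intro allI impI)
  fix e :: real assume "0 < e"
  with assms[of "e / 2"] reach_perturb_end[of "e / 2" x _ z "e / 2"] show "reach e x z" by auto
qed

lemma chains_to_limit_start:
  assumes "\<And>e. 0 < e \<Longrightarrow> \<exists>x'. dist x' x < e \<and> reach e x' z"
  shows "x \<leadsto> z"
  unfolding chains_to_def
proof (intro allI impI)
  fix e :: real assume "0 < e"
  then obtain d where d: "0 < d" "\<And>e' x x' z. dist x x' < d \<Longrightarrow> reach e' x z \<Longrightarrow> reach (e' + e / 2) x' z"
    using reach_perturb_start[of "e / 2"] by auto
  obtain x' where "dist x' x < min d (e / 2)" "reach (min d (e / 2)) x' z"
    using assms[of "min d (e / 2)"] d(1) \<open>0 < e\<close> by auto
  then have "dist x' x < d" "reach (e / 2) x' z" using reach_mono by auto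
  from d(2)[OF this] show "reach e x z" by simp
qed

lemma closed_chain_class: "closed (chain_class y)"
  unfolding closed_limpt
proof (intro allI impI)
  fix z assume "z islimpt chain_class y"
  then have *: "\<exists>z'. dist z' z < e \<and> z' \<in> chain_class y" if "0 < e" for e
    using that by (auto simp: islimpt_approachable)
  then have near: "\<exists>z'. dist z' z < e \<and> reach e y z' \<and> reach e z' y" if "0 < e" for e
    using that by (fastforce simp: chain_class_def chains_to_def)
  have "y \<leadsto> z" by (rule chains_to_limit_end) (use near in blast)
  moreover have "z \<leadsto> y" by (rule chains_to_limit_start) (use near in blast)
  ultimately show "z \<in> chain_class y" by (simp add: chain_class_def)
qed

section \<open>Leaving a fixed point inside a chain class\<close>

text \<open>The points reached by chains that start at \<open>p\<close> and have all nodes except possibly the last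
  one in \<open>B\<close>.\<close>

inductive first_exit :: "'a set \<Rightarrow> 'a \<Rightarrow> real \<Rightarrow> 'a \<Rightarrow> bool" for B p e where
  start: "first_exit B p e p"
| step: "first_exit B p e u \<Longrightarrow> u \<in> B \<Longrightarrow> jump e u w \<Longrightarrow> first_exit B p e w"

lemma first_exit_mono: "first_exit B p e w \<Longrightarrow> e \<le> e' \<Longrightarrow> first_exit B p e' w"
  by (induction rule: first_exit.induct) (auto intro: first_exit.intros jump_mono)

lemma first_exit_reach: "first_exit B p e w \<Longrightarrow> w = p \<or> reach e p w"
  by (induction rule: first_exit.induct) (auto intro: tranclp.intros)

lemma reach_first_exit:
  assumes "reach e p y" "p \<in> B" "y \<notin> B"
  shows "\<exists>w. first_exit B p e w \<and> w \<notin> B \<and> (w = y \<or> reach e w y)"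
proof -
  have "first_exit B p e y \<or> (\<exists>w. first_exit B p e w \<and> w \<notin> B \<and> (w = y \<or> reach e w y))"
    using assms(1)
  proof (induction rule: tranclp_induct)
    case (base y)
    then show ?case using assms(2) by (auto intro: first_exit.intros)
  next
    case (step u y)
    then show ?case by (metis first_exit.step tranclp.simps)
  qed
  then show ?thesis using assms(3) by blast
qed

text \<open>A limit of points reached from \<open>p\<close> has a past in \<open>B\<close>: the predecessors of the points
  converge to its image under time \<open>- T\<close>. The start \<open>p\<close>, which has no predecessor, is its own past
  because \<open>p\<close> is fixed.\<close>

lemma first_exit_limit_backward:
  assumes "v p T = p" "p \<in> B"
    and lim: "\<And>e. 0 < e \<Longrightarrow> \<exists>w'. first_exit B p e w' \<and> dist w w' < e"
    and "0 < e"
  shows "\<exists>u. first_exit B p e u \<and> u \<in> B \<and> dist (v w (- T)) u < e"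
proof -
  obtain d where d: "0 < d" "\<And>x y. dist x y < d \<Longrightarrow> dist (v x (- T)) (v y (- T)) < e"
    using flow_uniformly_continuous[OF assms(4)] by metis
  define d' where "d' = min (d / 2) e"
  have "0 < d'" using d(1) assms(4) by (simp add: d'_def)
  then obtain w' where w': "first_exit B p d' w'" "dist w w' < d'"
    using lim by blast
  have pT: "v p (- T) = p" using flow_flow[of p T "- T"] assms(1) by simp
  from w'(1) show ?thesis
  proof (cases rule: first_exit.cases)
    case start
    with d(2)[of w p] w'(2) pT assms(2) \<open>0 < d'\<close> d(1) show ?thesis
      by (intro exI[of _ p]) (auto simp: d'_def intro: first_exit.start)
  next
    case (step u)
    have "dist w (v u T) < d"
      using step(3) w'(2) dist_triangle[of w "v u T" w'] by (auto simp: jump_def d'_def dist_commute)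
    with d(2)[of w "v u T"] step first_exit_mono[of B p d' u e] show ?thesis
      by (intro exI[of _ u]) (auto simp: d'_def)
  qed
qed

text \<open>Fine chains from \<open>p\<close> to \<open>y\<close> have to leave a small ball around \<open>p\<close>. Their first nodes outside
  accumulate at a point \<open>w\<close> between \<open>p\<close> and \<open>y\<close>, and as all earlier nodes are in the ball,
  so is the past of \<open>w\<close>.\<close>

lemma exists_unstable_point_in_chain_class:
  assumes p: "p \<in> chain_class y" "p \<in> fixed_points v" and "y \<noteq> p" "y \<leadsto> y"
    and N: "open N" "p \<in> N"
  obtains w where "w \<in> chain_class y" "w \<noteq> p" "\<And>t. t \<le> 0 \<Longrightarrow> v w t \<in> N"
proof -
  have fixp: "v p t = p" for t using p(2) by (simp add: fixed_points_def)
  \<comment> \<open>Orbits that start close to the fixed point stay in \<open>N\<close> for the time between two nodes.\<close>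
  obtain d0 where d0: "0 < d0" "\<And>x t. dist p x \<le> d0 \<Longrightarrow> t \<in> {0..T} \<Longrightarrow> v x t \<in> N"
  proof -
    let ?S = "{z \<in> UNIV \<times> {0..T}. v (fst z) (snd z) \<notin> N}"
    have "closed ((\<lambda>z. v (fst z) (snd z)) -` (- N))"
      using N(1) by (intro closed_vimage continuous_intros) (auto simp: closed_Compl)
    then have "closed {z. v (fst z) (snd z) \<in> - N}" by (simp add: vimage_def)
    moreover have "?S = (UNIV \<times> {0..T}) \<inter> {z. v (fst z) (snd z) \<in> - N}" by auto
    ultimately have "compact ?S"
      using compact_Int_closed[OF compact_Times[OF compact_UNIV compact_Icc[of 0 T]]] by metis
    then have "compact (fst ` ?S)" by (intro compact_continuous_image continuous_intros)
    then have "open (- fst ` ?S)" by (simp add: compact_imp_closed open_Compl)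
    moreover have "p \<in> - fst ` ?S" using N(2) fixp by auto
    ultimately obtain d where "0 < d" "cball p d \<subseteq> - fst ` ?S"
      using open_contains_cball by blast
    then show ?thesis by (intro that[of d]) force+
  qed
  define d where "d = min d0 (dist p y)"
  have d: "0 < d" "d \<le> d0" "y \<notin> ball p d"
    using d0(1) assms(3) by (auto simp: d_def)
  define B where "B = ball p d"
  have pB: "p \<in> B" "y \<notin> B" using d by (auto simp: B_def)
  have "\<exists>w. first_exit B p e w \<and> w \<notin> B \<and> (w = y \<or> reach e w y)" if "0 < e" for e
    using reach_first_exit[of e p y B] pB p(1) that by (auto simp: chain_class_def chains_to_def)
  then have "\<forall>n. \<exists>w. first_exit B p (inverse (real (Suc n))) w \<and> w \<notin> B
      \<and> (w = y \<or> reach (inverse (real (Suc n))) w y)"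
    by simp
  then obtain f where f: "\<And>n. first_exit B p (inverse (real (Suc n))) (f n)" "\<And>n. f n \<notin> B"
      "\<And>n. f n = y \<or> reach (inverse (real (Suc n))) (f n) y"
    by metis
  obtain w r where r: "strict_mono (r :: nat \<Rightarrow> nat)" "(\<lambda>n. f (r n)) \<longlonglongrightarrow> w"
    by (rule convergent_subsequence)
  have lim: "\<exists>w'. first_exit B p e w' \<and> dist w w' < e \<and> w' \<notin> B \<and> (w' = y \<or> reach e w' y)"
    if "0 < e" for e
  proof -
    have "(\<lambda>n. inverse (real (Suc (r n)))) \<longlonglongrightarrow> 0"
      using LIMSEQ_subseq_LIMSEQ[OF LIMSEQ_inverse_real_of_nat r(1)] by (simp add: o_def)
    then have "\<forall>\<^sub>F n in sequentially. inverse (real (Suc (r n))) < e"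
      using that by (rule order_tendstoD)
    moreover have "\<forall>\<^sub>F n in sequentially. dist (f (r n)) w < e"
      using r(2) that by (rule tendstoD)
    ultimately obtain n where n: "inverse (real (Suc (r n))) < e" "dist (f (r n)) w < e"
      using eventually_happens[OF eventually_conj] by fastforce
    with f[of "r n"] show ?thesis
      by (intro exI[of _ "f (r n)"]) (auto simp: dist_commute intro: first_exit_mono reach_mono)
  qed
  have "closed (- B)" by (simp add: B_def closed_Compl)
  with r(2) f(2) have "w \<in> - B"
    by (metis Compl_iff closed_sequentially)
  then have "w \<noteq> p" using pB by auto
  have reach_w: "\<exists>w'. dist w' w < e \<and> reach e p w'" if "0 < e" for e
    using lim[OF that] first_exit_reach pB(1) by (metis dist_commute)
  have "p \<leadsto> w" by (rule chains_to_limit_end[OF reach_w])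
  have w_reach: "\<exists>w'. dist w' w < e \<and> reach e w' y" if "0 < e" for e
    using lim[OF that] assms(4) that unfolding chains_to_def by (metis dist_commute)
  have "w \<leadsto> y" by (rule chains_to_limit_start[OF w_reach])
  have in_class: "w \<in> chain_class y"
    using \<open>w \<leadsto> y\<close> p(1) chains_to_trans[OF _ \<open>p \<leadsto> w\<close>] by (simp add: chain_class_def)
  \<comment> \<open>The first conjunct makes the next application of \<open>first_exit_limit_backward\<close> possible;
    at \<open>n = 0\<close> the point \<open>w\<close> itself lies outside the ball.\<close>
  have backward: "(\<forall>e>0. \<exists>u. first_exit B p e u \<and> dist (v w (- real n * T)) u < e) \<and>
      (0 < n \<longrightarrow> dist p (v w (- real n * T)) \<le> d)" for n
  proof (induction n)
    case 0
    then show ?case using lim by fastforce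
  next
    case (Suc n)
    have *: "v (v w (- real n * T)) (- T) = v w (- real (Suc n) * T)"
      by (simp add: algebra_simps)
    have 1: "\<exists>u. first_exit B p e u \<and> u \<in> B \<and> dist (v w (- real (Suc n) * T)) u < e" if "0 < e" for e
      using first_exit_limit_backward[of p B "v w (- real n * T)" e] fixp pB(1) Suc that
      unfolding * by blast
    have "dist p (v w (- real (Suc n) * T)) \<le> d"
    proof (rule field_le_epsilon)
      fix e :: real assume "0 < e"
      from 1[OF this] obtain u where "dist p u < d" "dist (v w (- real (Suc n) * T)) u < e"
        by (auto simp: B_def)
      then show "dist p (v w (- real (Suc n) * T)) \<le> d + e"
        using dist_triangle[of p "v w (- real (Suc n) * T)" u] by (simp add: dist_commute)
    qed
    with 1 show ?case by blast
  qed
  have "v w t \<in> N" if "t \<le> 0" for t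
  proof -
    \<comment> \<open>The least multiple of \<open>T\<close> exceeding \<open>- t\<close>; it is positive, so
      the point at time \<open>- n T\<close> lies in the closed ball.\<close>
    define n where "n = nat \<lfloor>- t / T\<rfloor> + 1"
    have "0 \<le> - t / T" using that T_pos by (simp add: divide_nonpos_pos)
    then have "- t / T < real n" "real n \<le> - t / T + 1" unfolding n_def by linarith+
    then have "t + real n * T \<in> {0..T}" using T_pos by (auto simp: field_simps)
    moreover have "dist p (v w (- real n * T)) \<le> d0" using backward[of n] d(2) by (simp add: n_def)
    ultimately have "v (v w (- real n * T)) (t + real n * T) \<in> N" using d0(2) by blast
    then show ?thesis by simp
  qed
  with in_class \<open>w \<noteq> p\<close> that show ?thesis by blast
qed

section \<open>A Lyapunov function from chains\<close>

text \<open>In contrast to \<open>reach\<close>, a jump is allowed before the first flow step and the sum of the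
  jumps is recorded. The infimum of these sums is Lipschitz in both end points.\<close>

inductive chain_cost :: "'a \<Rightarrow> 'a \<Rightarrow> real \<Rightarrow> bool" where
  start: "chain_cost x z (dist x z)"
| snoc: "chain_cost x u c \<Longrightarrow> chain_cost x z (c + dist (v u T) z)"

lemma chain_cost_nonneg: "chain_cost x z c \<Longrightarrow> 0 \<le> c"
  by (induction rule: chain_cost.induct) auto

lemma chain_cost_perturb_end: "chain_cost x z c \<Longrightarrow> \<exists>c'. chain_cost x z' c' \<and> c' \<le> c + dist z z'"
proof (induction rule: chain_cost.induct)
  case (start x z)
  show ?case using chain_cost.start[of x z'] dist_triangle[of x z' z] by blast
next
  case (snoc x u c z)
  from chain_cost.snoc[OF snoc(1), of z'] show ?case
    using dist_triangle[of "v u T" z' z] by fastforce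
qed

lemma chain_cost_perturb_start: "chain_cost x z c \<Longrightarrow> \<exists>c'. chain_cost x' z c' \<and> c' \<le> c + dist x x'"
proof (induction rule: chain_cost.induct)
  case (start x z)
  show ?case using chain_cost.start[of x' z] dist_triangle[of x' z x]
    by (metis add.commute dist_commute)
next
  case (snoc x u c z)
  then obtain c' where "chain_cost x' u c'" "c' \<le> c + dist x x'" by blast
  from chain_cost.snoc[OF this(1), of z] this(2) show ?case by fastforce
qed

lemma chain_cost_reach: "chain_cost x z c \<Longrightarrow> x = v y T \<Longrightarrow> c < e \<Longrightarrow> reach e y z"
proof (induction rule: chain_cost.induct)
  case (start x z)
  then show ?case by (auto simp: jump_def)
next
  case (snoc x u c z)
  have "jump e u z" using snoc chain_cost_nonneg[OF snoc(1)] by (simp add: jump_def)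
  moreover have "reach e y u" using snoc zero_le_dist[of "v u T" z] by simp
  ultimately show ?case by (meson tranclp.trancl_into_trancl)
qed

definition cost :: "'a \<Rightarrow> 'a \<Rightarrow> real" where
  "cost x z = Inf {c. chain_cost x z c}"

lemma cost_le: "chain_cost x z c \<Longrightarrow> cost x z \<le> c"
  unfolding cost_def by (rule cInf_lower) (auto intro!: bdd_belowI[of _ 0] chain_cost_nonneg)

lemma cost_greatest: "(\<And>c. chain_cost x z c \<Longrightarrow> b \<le> c) \<Longrightarrow> b \<le> cost x z"
  unfolding cost_def by (rule cInf_greatest) (auto intro: chain_cost.start)

lemma cost_nonneg: "0 \<le> cost x z"
  by (rule cost_greatest) (rule chain_cost_nonneg)

lemma cost_le_dist: "cost x z \<le> dist x z"
  by (rule cost_le) (rule chain_cost.start)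

lemma cost_perturb_end: "cost x z' \<le> cost x z + dist z z'"
proof -
  have "cost x z' - dist z z' \<le> cost x z"
  proof (rule cost_greatest)
    fix c assume "chain_cost x z c"
    then obtain c' where "chain_cost x z' c'" "c' \<le> c + dist z z'"
      using chain_cost_perturb_end by blast
    with cost_le[of x z' c'] show "cost x z' - dist z z' \<le> c" by simp
  qed
  then show ?thesis by simp
qed

lemma cost_perturb_start: "cost x' z \<le> cost x z + dist x x'"
proof -
  have "cost x' z - dist x x' \<le> cost x z"
  proof (rule cost_greatest)
    fix c assume "chain_cost x z c"
    then obtain c' where "chain_cost x' z c'" "c' \<le> c + dist x x'"
      using chain_cost_perturb_start by blast
    with cost_le[of x' z c'] show "cost x' z - dist x x' \<le> c" by simp
  qed
  then show ?thesis by simp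
qed

text \<open>A chain to \<open>z\<close> can be prolonged to \<open>v z T\<close> without a jump.\<close>

lemma cost_flow_le: "cost x (v z T) \<le> cost x z"
  by (rule cost_greatest) (use chain_cost.snoc[where z = "v z T" and u = z] cost_le in fastforce)

text \<open>Put in front of a chain from \<open>v y T\<close> to \<open>y\<close>, the orbit segment from \<open>y\<close> to \<open>v y T\<close> makes it
  a closed chain through \<open>y\<close>.\<close>

lemma cost_pos:
  assumes "\<not> y \<leadsto> y"
  shows "0 < cost (v y T) y"
proof -
  obtain e where e: "0 < e" "\<not> reach e y y" using assms by (auto simp: chains_to_def)
  have "e \<le> cost (v y T) y"
    by (rule cost_greatest) (use e(2) chain_cost_reach in force)
  with e(1) show ?thesis by simp
qed

lemma continuous_on_cost: "continuous_on S (cost x)"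
  unfolding continuous_on_iff
proof (intro ballI allI impI)
  fix z :: 'a and e :: real assume "0 < e"
  have "dist (cost x z') (cost x z) < e" if "dist z' z < e" for z'
    using cost_perturb_end[of x z' z] cost_perturb_end[of x z z'] that
    by (auto simp: dist_real_def abs_less_iff dist_commute)
  with \<open>0 < e\<close> show "\<exists>d>0. \<forall>z'\<in>S. dist z' z < d \<longrightarrow> dist (cost x z') (cost x z) < e" by blast
qed

lemma countable_dense:
  obtains q :: "nat \<Rightarrow> 'a" where "\<And>x e. 0 < e \<Longrightarrow> \<exists>n. dist (q n) x < e"
proof -
  have "\<exists>k. finite k \<and> (UNIV :: 'a set) \<subseteq> (\<Union>x\<in>k. ball x (inverse (real (Suc n))))" for n
  proof -
    have "0 < inverse (real (Suc n))" by simp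
    from seq_compact_imp_totally_bounded[OF compact_imp_seq_compact[OF compact_UNIV],
        rule_format, OF this]
    show ?thesis by blast
  qed
  then obtain k :: "nat \<Rightarrow> 'a set" where k: "\<And>n. finite (k n)"
      "\<And>n. UNIV \<subseteq> (\<Union>x\<in>k n. ball x (inverse (real (Suc n))))"
    by metis
  let ?D = "\<Union>n. k n"
  have D: "countable ?D" using k(1) by (simp add: countable_finite)
  have "\<exists>n. dist (from_nat_into ?D n) x < e" if e: "0 < e" for x e
  proof -
    obtain n where n: "inverse (real (Suc n)) < e" using reals_Archimedean[OF e] by blast
    obtain a where a: "a \<in> k n" "dist a x < inverse (real (Suc n))"
      using k(2)[of n, THEN subsetD, OF UNIV_I, of x] by (auto simp del: of_nat_Suc)
    then obtain m where "from_nat_into ?D m = a" using from_nat_into_surj[OF D, of a] by auto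
    with a(2) n show ?thesis by (intro exI[of _ m]) auto
  qed
  with that show ?thesis by blast
qed

text \<open>Each function \<open>cost x\<close> is weakly decreasing under the time-\<open>T\<close> map, and \<open>cost (v z T)\<close> is strictly
  so at a point \<open>z\<close> that is not chain recurrent: it vanishes at \<open>v z T\<close> but not at \<open>z\<close>. By the
  Lipschitz property in the first argument a countable dense set of base points suffices, and a
  weighted series of the corresponding functions is strictly decreasing at all these points.\<close>

lemma time_T_Lyapunov:
  obtains G :: "'a \<Rightarrow> real" where "continuous_on UNIV G" "\<And>z. \<not> z \<leadsto> z \<Longrightarrow> G (v z T) < G z"
proof -
  obtain q :: "nat \<Rightarrow> 'a" where q: "\<And>x e. 0 < e \<Longrightarrow> \<exists>n. dist (q n) x < e"
    by (rule countable_dense) blast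
  obtain D where D: "\<And>x y :: 'a. dist x y \<le> D"
    using compact_imp_bounded[OF compact_UNIV] unfolding bounded_two_points by auto
  define f where "f n z = (1 / 2) ^ n * cost (q n) z" for n z
  have f: "norm (f n z) \<le> (1 / 2) ^ n * D" for n z
    using cost_le_dist[of "q n" z] D[of "q n" z] cost_nonneg[of "q n" z]
    by (auto simp: f_def abs_mult intro!: mult_left_mono)
  have "summable (\<lambda>n. (1 / 2) ^ n * D)"
    by (intro summable_mult2 summable_geometric) auto
  note ul = Weierstrass_m_test[of UNIV f, OF f this]
    and sm = summable_comparison_test'[OF this f]
  define G where "G z = (\<Sum>n. f n z)" for z
  have cont: "continuous_on UNIV G"
    unfolding G_def
    by (rule uniform_limit_theorem[OF _ ul])
      (auto simp: f_def intro!: always_eventually continuous_intros continuous_on_cost)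
  have fle: "f n (v z T) \<le> f n z" for n z
    using cost_flow_le by (simp add: f_def)
  have less: "G (v z T) < G z" if z: "\<not> z \<leadsto> z" for z
  proof -
    obtain n where n: "dist (q n) (v z T) < cost (v z T) z / 2"
      using q[of "cost (v z T) z / 2" "v z T"] cost_pos[OF z] by auto
    have "cost (q n) (v z T) < cost (q n) z"
      using n cost_le_dist[of "q n" "v z T"] cost_perturb_start[of "v z T" z "q n"] by linarith
    then have "0 < f n z - f n (v z T)" by (simp add: f_def)
    then have "0 < (\<Sum>n. f n z - f n (v z T))"
      by (intro suminf_pos2[where i = n] summable_diff sm) (use fle in auto)
    then show ?thesis by (simp add: G_def suminf_diff[OF sm sm, symmetric])
  qed
  show ?thesis using that cont less by blast
qed

text \<open>Averaging a function that decreases under the time-\<open>T\<close> map over orbit segments of length \<open>T\<close> gives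
  a function that decreases along the flow, since the derivative of the average along an orbit is
  the increment of the function over time \<open>T\<close>.\<close>

lemma gradient_like_if_no_chain_recurrence:
  assumes "\<And>y. y \<notin> fixed_points v \<Longrightarrow> \<not> y \<leadsto> y"
  shows "gradient_like v"
proof -
  obtain G :: "'a \<Rightarrow> real" where G: "continuous_on UNIV G"
    "\<And>z. \<not> z \<leadsto> z \<Longrightarrow> G (v z T) < G z"
    by (rule time_T_Lyapunov) blast
  have Gcont [continuous_intros]: "continuous_on S (\<lambda>w. G (h w))" if "continuous_on S h"
    for S :: "'b::topological_space set" and h
    using continuous_on_compose2[OF G(1) that] by auto
  define g where "g y = integral {0..T} (\<lambda>t. G (v y t))" for y
  have "continuous_on UNIV (\<lambda>y. integral (cbox 0 T) (\<lambda>t. G (v y t)))"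
    unfolding case_prod_unfold
    by (rule integral_continuous_on_param)
      (auto simp: case_prod_unfold intro!: continuous_intros)
  then have cont: "continuous_on UNIV g" by (simp add: g_def cbox_interval)
  have "g (v y t) < g (v y s)" if y: "y \<notin> fixed_points v" and "s < t" for y s t
  proof -
    define c where "c u = G (v y u)" for u
    have c [continuous_intros]: "continuous_on S c" for S
      unfolding c_def by (intro continuous_intros)
    define a where "a = s - 1"
    define b where "b = t + T + 1"
    define P where "P u = integral {a..u} c" for u
    have P: "(P has_real_derivative c u) (at u)" if "a < u" "u < b" for u
    proof -
      have "(P has_real_derivative c u) (at u within {a..b})"
        unfolding P_def using that by (intro integral_has_real_derivative c) auto
      with that show ?thesis
        by (simp add: at_within_Icc_at)
    qed
    have gP: "g (v y u) = P (u + T) - P u" if "a \<le> u" for u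
    proof -
      have "g (v y u) = integral {0..T} (\<lambda>\<tau>. c (\<tau> + u))"
        by (simp add: g_def c_def add.commute)
      also have "\<dots> = integral {u..T + u} c"
        using integral_shift_Icc_real[of 0 T c u] by (simp add: o_def add.commute)
      also have "\<dots> = P (u + T) - P u"
        using Henstock_Kurzweil_Integration.integral_combine[of a u "T + u" c] T_pos that
        by (simp add: P_def add.commute integrable_continuous_real c)
      finally show ?thesis .
    qed
    have not_rec: "\<not> v y u \<leadsto> v y u" for u
    proof (rule assms)
      show "v y u \<notin> fixed_points v"
      proof
        assume "v y u \<in> fixed_points v"
        then have *: "v y (u + w) = v y u" for w by (simp add: fixed_points_def)
        have "v y w = y" for w using *[of "w - u"] *[of "- u"] by simp
        with y show False by (simp add: fixed_points_def)
      qed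
    qed
    have "P (t + T) - P t < P (s + T) - P s"
    proof (rule DERIV_neg_imp_decreasing[OF \<open>s < t\<close>])
      fix u assume u: "s \<le> u" "u \<le> t"
      have "((\<lambda>u. P (u + T)) has_real_derivative c (u + T)) (at u)"
        using P[of "u + T"] u T_pos by (simp add: DERIV_shift a_def b_def)
      moreover have "(P has_real_derivative c u) (at u)"
        using P[of u] u T_pos by (simp add: a_def b_def)
      ultimately have "((\<lambda>u. P (u + T) - P u) has_real_derivative c (u + T) - c u) (at u)"
        by (rule DERIV_diff)
      moreover have "c (u + T) - c u < 0"
        using G(2)[OF not_rec[of u]] by (simp add: c_def)
      ultimately show "\<exists>d. ((\<lambda>u. P (u + T) - P u) has_real_derivative d) (at u) \<and> d < 0" by blast
    qed
    then show ?thesis using \<open>s < t\<close> by (simp add: gP a_def)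
  qed
  with cont show ?thesis unfolding gradient_like_def by blast
qed

end

section \<open>Cocycles and curve integrals\<close>

lemma continuous_cocycleE:
  assumes "continuous_cocycle \<alpha>"
  obtains r where "0 < r"
    "\<And>c x z. dist c x < r \<Longrightarrow> dist c z < r \<Longrightarrow> \<alpha> c z = \<alpha> c x + \<alpha> x z"
    "\<And>c e. 0 < e \<Longrightarrow> \<exists>d>0. \<forall>z. dist c z < d \<longrightarrow> \<bar>\<alpha> c z\<bar> < e"
proof -
  obtain r where r: "0 < r" "\<And>c. \<exists>\<beta>. continuous_on (closure (ball c r)) \<beta> \<and>
      (\<forall>x\<in>closure (ball c r). \<forall>y\<in>closure (ball c r). \<alpha> x y = \<beta> y - \<beta> x)"
    using assms unfolding continuous_cocycle_def by metis
  have in_cl: "x \<in> closure (ball c r)" if "dist c x < r" for c x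
    using closure_subset[of "ball c r"] that by auto
  have add: "\<alpha> c z = \<alpha> c x + \<alpha> x z" if "dist c x < r" "dist c z < r" for c x z
    using r(2)[of c] in_cl[of c c] in_cl[OF that(1)] in_cl[OF that(2)] r(1) by force
  have lim: "\<exists>d>0. \<forall>z. dist c z < d \<longrightarrow> \<bar>\<alpha> c z\<bar> < e" if e: "0 < e" for c e
  proof -
    obtain \<beta> where \<beta>: "continuous_on (closure (ball c r)) \<beta>"
      "\<And>x y. x \<in> closure (ball c r) \<Longrightarrow> y \<in> closure (ball c r) \<Longrightarrow> \<alpha> x y = \<beta> y - \<beta> x"
      using r(2)[of c] by blast
    obtain d where d: "0 < d" "\<And>z. z \<in> closure (ball c r) \<Longrightarrow> dist z c < d \<Longrightarrow> dist (\<beta> z) (\<beta> c) < e"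
      using \<beta>(1) in_cl[of c c] r(1) e unfolding continuous_on_iff by (metis dist_self)
    have "\<bar>\<alpha> c z\<bar> < e" if "dist c z < min d r" for z
      using d(2)[of z] \<beta>(2)[of c z] in_cl[of c z] in_cl[of c c] r(1) that
      by (simp add: dist_commute dist_real_def)
    with d(1) r(1) show ?thesis by (intro exI[of _ "min d r"]) auto
  qed
  show ?thesis using that[OF r(1) add lim] by blast
qed

lemma fine_subdivision_in_interval:
  assumes "fine_subdivision \<delta> a b m \<tau>" "i \<le> m"
  shows "\<tau> i \<in> {a..b}"
proof -
  have mono: "\<tau> i \<le> \<tau> j" if "i \<le> j" "j \<le> m" for i j
    using that
  proof (induction j rule: dec_induct)
    case (step n)
    then have "\<tau> n < \<tau> (Suc n)" using assms(1) by (simp add: fine_subdivision_def)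
    with step show ?case by simp
  qed simp
  show ?thesis
    using mono[of 0 i] mono[of i m] assms by (auto simp: fine_subdivision_def)
qed

lemma fine_subdivision_exists:
  assumes "a \<le> b" "0 < \<delta>"
  shows "\<exists>m \<tau>. fine_subdivision \<delta> a b m \<tau>"
proof (cases "a = b")
  case True
  then show ?thesis by (intro exI[of _ 0] exI[of _ "\<lambda>_. a"]) (simp add: fine_subdivision_def)
next
  case False
  then have "a < b" using assms by simp
  obtain n where n: "(b - a) / \<delta> < real (Suc n)"
    using reals_Archimedean2[of "(b - a) / \<delta>"] by (metis lessI less_trans of_nat_less_iff)
  define h where "h = (b - a) / real (Suc n)"
  have h: "0 < h" "h < \<delta>" "real (Suc n) * h = b - a"
    using \<open>a < b\<close> n assms(2) by (auto simp: h_def field_simps)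
  have "fine_subdivision \<delta> a b (Suc n) (\<lambda>i. a + real i * h)"
    unfolding fine_subdivision_def using h by (auto simp: algebra_simps)
  then show ?thesis by blast
qed

text \<open>The sums telescope on every subdivision finer than \<open>\<eta>\<close>; that such subdivisions exist makes the
  value unique.\<close>

lemma curve_integral_eqI:
  assumes "a \<le> b" "0 < \<eta>"
    and f: "\<And>s t. s \<in> {a..b} \<Longrightarrow> t \<in> {a..b} \<Longrightarrow> \<bar>t - s\<bar> < \<eta> \<Longrightarrow> \<alpha> (\<gamma> s) (\<gamma> t) = f t - f s"
  shows "curve_integral \<alpha> \<gamma> a b = f b - f a"
proof -
  have sums: "(\<Sum>i<m. \<alpha> (\<gamma> (\<tau> i)) (\<gamma> (\<tau> (Suc i)))) = f b - f a"
    if "fine_subdivision \<eta> a b m \<tau>" for m \<tau>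
  proof -
    have "(\<Sum>i<m. \<alpha> (\<gamma> (\<tau> i)) (\<gamma> (\<tau> (Suc i)))) = (\<Sum>i<m. f (\<tau> (Suc i)) - f (\<tau> i))"
    proof (rule sum.cong[OF refl])
      fix i assume "i \<in> {..<m}"
      then show "\<alpha> (\<gamma> (\<tau> i)) (\<gamma> (\<tau> (Suc i))) = f (\<tau> (Suc i)) - f (\<tau> i)"
        using fine_subdivision_in_interval[OF that, of i]
          fine_subdivision_in_interval[OF that, of "Suc i"] that
        by (intro f) (auto simp: fine_subdivision_def abs_if)
    qed
    also have "\<dots> = f (\<tau> m) - f (\<tau> 0)" by (rule sum_lessThan_telescope)
    finally show ?thesis using that by (simp add: fine_subdivision_def)
  qed
  show ?thesis
    unfolding curve_integral_def
  proof (rule the_equality)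
    show "\<exists>\<delta>>0. \<forall>m \<tau>. fine_subdivision \<delta> a b m \<tau> \<longrightarrow>
        (\<Sum>i<m. \<alpha> (\<gamma> (\<tau> i)) (\<gamma> (\<tau> (Suc i)))) = f b - f a"
      using sums assms(2) by blast
  next
    fix I assume "\<exists>\<delta>>0. \<forall>m \<tau>. fine_subdivision \<delta> a b m \<tau> \<longrightarrow>
        (\<Sum>i<m. \<alpha> (\<gamma> (\<tau> i)) (\<gamma> (\<tau> (Suc i)))) = I"
    then obtain \<delta> where \<delta>: "0 < \<delta>" "\<And>m \<tau>. fine_subdivision \<delta> a b m \<tau> \<Longrightarrow>
        (\<Sum>i<m. \<alpha> (\<gamma> (\<tau> i)) (\<gamma> (\<tau> (Suc i)))) = I"
      by blast
    obtain m \<tau> where \<tau>: "fine_subdivision (min \<delta> \<eta>) a b m \<tau>"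
      using fine_subdivision_exists[OF assms(1), of "min \<delta> \<eta>"] \<delta>(1) assms(2) by auto
    then have "fine_subdivision \<delta> a b m \<tau>" "fine_subdivision \<eta> a b m \<tau>"
      by (auto simp: fine_subdivision_def)
    with \<delta>(2) sums show "I = f b - f a" by metis
  qed
qed

text \<open>Compactness turns the open neighbourhoods of the diagonal in the definition of
  \<open>primitive_on\<close> into metric ones.\<close>

lemma open_diagonal_uniform:
  fixes S :: "'a::metric_space set"
  assumes "compact S" "open N" "\<And>x. x \<in> S \<Longrightarrow> (x, x) \<in> N"
  obtains e where "0 < e" "\<And>x y. x \<in> S \<Longrightarrow> dist x y < e \<Longrightarrow> (x, y) \<in> N"
proof -
  have "\<exists>G. open G \<and> x \<in> G \<and> G \<times> G \<subseteq> N" if x: "x \<in> S" for x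
  proof -
    obtain A B where "open A" "open B" "(x, x) \<in> A \<times> B" "A \<times> B \<subseteq> N"
      using open_prod_elim[OF assms(2) assms(3)[OF x]] by metis
    then show ?thesis by (intro exI[of _ "A \<inter> B"]) auto
  qed
  then have "S \<subseteq> \<Union>{G. open G \<and> G \<times> G \<subseteq> N}" by blast
  then obtain e where e: "0 < e" "\<And>x. x \<in> S \<Longrightarrow> \<exists>G\<in>{G. open G \<and> G \<times> G \<subseteq> N}. ball x e \<subseteq> G"
    using Heine_Borel_lemma[OF assms(1), of "{G. open G \<and> G \<times> G \<subseteq> N}"] by blast
  have "(x, y) \<in> N" if x: "x \<in> S" and xy: "dist x y < e" for x y
  proof -
    obtain G where G: "G \<times> G \<subseteq> N" "ball x e \<subseteq> G" using e(2)[OF x] by blast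
    have "x \<in> ball x e" "y \<in> ball x e" using xy e(1) by auto
    with G show ?thesis by blast
  qed
  with e(1) that show ?thesis by blast
qed

lemma curve_integral_primitive:
  fixes \<gamma> :: "real \<Rightarrow> 'a::metric_space"
  assumes \<beta>: "primitive_on \<alpha> S \<beta>" and \<gamma>: "continuous_on {a..b} \<gamma>" "\<gamma> ` {a..b} \<subseteq> S" and "a \<le> b"
  shows "curve_integral \<alpha> \<gamma> a b = \<beta> (\<gamma> b) - \<beta> (\<gamma> a)"
proof -
  obtain N where N: "open N" "\<And>x. x \<in> S \<Longrightarrow> (x, x) \<in> N"
      "\<And>x y. x \<in> S \<Longrightarrow> y \<in> S \<Longrightarrow> (x, y) \<in> N \<Longrightarrow> \<alpha> x y = \<beta> y - \<beta> x"
    using \<beta> unfolding primitive_on_def by metis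
  have "compact (\<gamma> ` {a..b})" by (intro compact_continuous_image \<gamma>(1) compact_Icc)
  then obtain e where e: "0 < e" "\<And>x y. x \<in> \<gamma> ` {a..b} \<Longrightarrow> dist x y < e \<Longrightarrow> (x, y) \<in> N"
    using open_diagonal_uniform[OF _ N(1), of "\<gamma> ` {a..b}"] N(2) \<gamma>(2) by (metis subsetD)
  have "uniformly_continuous_on {a..b} \<gamma>"
    by (intro compact_uniformly_continuous \<gamma>(1) compact_Icc)
  then obtain \<eta> where \<eta>: "0 < \<eta>" "\<And>s t. s \<in> {a..b} \<Longrightarrow> t \<in> {a..b} \<Longrightarrow> dist t s < \<eta> \<Longrightarrow>
      dist (\<gamma> t) (\<gamma> s) < e"
    using e(1) unfolding uniformly_continuous_on_def by metis
  show ?thesis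
  proof (rule curve_integral_eqI[OF \<open>a \<le> b\<close> \<eta>(1), where f = "\<lambda>t. \<beta> (\<gamma> t)"])
    fix s t assume st: "s \<in> {a..b}" "t \<in> {a..b}" "\<bar>t - s\<bar> < \<eta>"
    then have "dist (\<gamma> s) (\<gamma> t) < e" using \<eta>(2)[of s t] by (simp add: dist_commute dist_real_def)
    with st e(2) \<gamma>(2) show "\<alpha> (\<gamma> s) (\<gamma> t) = \<beta> (\<gamma> t) - \<beta> (\<gamma> s)"
      by (intro N(3)) auto
  qed
qed

section \<open>A primitive on a chain class\<close>

context compact_flow_step
begin

inductive chain_sum :: "('a \<Rightarrow> 'a \<Rightarrow> real) \<Rightarrow> real \<Rightarrow> 'a \<Rightarrow> 'a \<Rightarrow> real \<Rightarrow> bool" for \<alpha> e where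
  single: "jump e x z \<Longrightarrow> chain_sum \<alpha> e x z (curve_integral \<alpha> (v x) 0 T + \<alpha> (v x T) z)"
| snoc: "chain_sum \<alpha> e x u I \<Longrightarrow> jump e u z \<Longrightarrow>
    chain_sum \<alpha> e x z (I + (curve_integral \<alpha> (v u) 0 T + \<alpha> (v u T) z))"

lemma reach_chain_sum: "reach e x z \<Longrightarrow> \<exists>I. chain_sum \<alpha> e x z I"
  by (induction rule: tranclp_induct) (auto intro: chain_sum.intros)

text \<open>The second chain comes first among the premises because the induction is on it.\<close>

lemma chain_sum_trans: "chain_sum \<alpha> e y z J \<Longrightarrow> chain_sum \<alpha> e x y I \<Longrightarrow> chain_sum \<alpha> e x z (I + J)"
proof (induction rule: chain_sum.induct)
  case (single y z)
  then show ?case by (intro chain_sum.snoc)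
next
  case (snoc y u J z)
  from chain_sum.snoc[OF snoc.IH[OF snoc.prems] snoc.hyps(2)] show ?case
    by (simp add: add.assoc)
qed

text \<open>Going around a closed chain \<open>n\<close> times multiplies its integral by \<open>n\<close>.\<close>

lemma closed_chain_sum_eq_0:
  assumes bnd: "\<And>x z I. chain_sum \<alpha> e x z I \<Longrightarrow> \<bar>I\<bar> < M" and I: "chain_sum \<alpha> e x x I"
  shows "I = 0"
proof (rule ccontr)
  assume "I \<noteq> 0"
  have n: "chain_sum \<alpha> e x x (real (Suc n) * I)" for n
  proof (induction n)
    case (Suc n)
    from chain_sum_trans[OF I Suc] show ?case by (simp add: algebra_simps)
  qed (use I in simp)
  obtain n where "M < real n * \<bar>I\<bar>" using \<open>I \<noteq> 0\<close> reals_Archimedean3[of "\<bar>I\<bar>"] by auto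
  moreover have "real (Suc n) * \<bar>I\<bar> < M" using bnd[OF n[of n]] by (simp add: abs_mult)
  ultimately show False by (simp add: algebra_simps)
qed

text \<open>The primitive at \<open>z\<close> is the integral over any chain from \<open>y\<close> to \<open>z\<close>. Two such chains have the same
  integral, since both are closed by one chain from \<open>z\<close> back to \<open>y\<close>. Moving the end of the chain
  from \<open>z\<close> to a nearby point \<open>z'\<close> changes only the last jump, and by the cocycle
  property it changes the integral by \<open>\<alpha> z z'\<close>.\<close>

lemma primitive_on_chain_class:
  assumes \<alpha>: "continuous_cocycle \<alpha>" and "0 < e"
    and bnd: "\<And>x z I. chain_sum \<alpha> e x z I \<Longrightarrow> \<bar>I\<bar> < M"
  shows "\<exists>\<beta>. primitive_on \<alpha> (chain_class y) \<beta>"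
proof -
  obtain r where r: "0 < r"
    "\<And>c x z. dist c x < r \<Longrightarrow> dist c z < r \<Longrightarrow> \<alpha> c z = \<alpha> c x + \<alpha> x z"
    "\<And>c e. 0 < e \<Longrightarrow> \<exists>d>0. \<forall>z. dist c z < d \<longrightarrow> \<bar>\<alpha> c z\<bar> < e"
    using continuous_cocycleE[OF \<alpha>] by metis
  \<comment> \<open>Two consecutive jumps shorter than \<open>d\<close> form an admissible jump inside a ball on which
    \<open>\<alpha>\<close> is additive.\<close>
  define d where "d = min e r / 2"
  have d: "0 < d" "d \<le> e / 2" "d \<le> r / 2" using \<open>0 < e\<close> r(1) by (auto simp: d_def)
  define \<beta> where "\<beta> z = (THE I. chain_sum \<alpha> e y z I)" for z
  have uniq: "I = J" if z: "z \<in> chain_class y" and I: "chain_sum \<alpha> e y z I" and J: "chain_sum \<alpha> e y z J"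
    for z I J
  proof -
    obtain L where L: "chain_sum \<alpha> e z y L"
      using z \<open>0 < e\<close> reach_chain_sum[of e z y \<alpha>] by (auto simp: chain_class_def chains_to_def)
    have "I + L = 0" using bnd chain_sum_trans[OF L I] by (rule closed_chain_sum_eq_0)
    moreover have "J + L = 0" using bnd chain_sum_trans[OF L J] by (rule closed_chain_sum_eq_0)
    ultimately show ?thesis by simp
  qed
  have \<beta>: "\<beta> z = I" if "z \<in> chain_class y" "chain_sum \<alpha> e y z I" for z I
    unfolding \<beta>_def using that uniq by (intro the_equality) blast+
  have step: "\<exists>I. chain_sum \<alpha> e y z I \<and> chain_sum \<alpha> e y z' (I + \<alpha> z z')"
    if z: "z \<in> chain_class y" "dist z z' < d" for z z'
  proof -
    have "reach d y z" using z(1) d(1) by (simp add: chain_class_def chains_to_def)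
    then show ?thesis
    proof (cases rule: tranclp.cases)
      case r_into_trancl
      then have *: "dist (v y T) z < d" by (simp add: jump_def)
      then have "dist (v y T) z' < 2 * d" using z(2) dist_triangle[of "v y T" z' z] by simp
      with * d have "jump e y z" "jump e y z'" "\<alpha> (v y T) z' = \<alpha> (v y T) z + \<alpha> z z'"
        by (auto simp: jump_def intro!: r(2))
      then show ?thesis
        using chain_sum.single[of e y z \<alpha>] chain_sum.single[of e y z' \<alpha>] by (metis add.assoc)
    next
      case (trancl_into_trancl u)
      then have *: "dist (v u T) z < d" by (simp add: jump_def)
      then have "dist (v u T) z' < 2 * d" using z(2) dist_triangle[of "v u T" z' z] by simp
      with * d have **: "jump e u z" "jump e u z'" "\<alpha> (v u T) z' = \<alpha> (v u T) z + \<alpha> z z'"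
        by (auto simp: jump_def intro!: r(2))
      have "reach e y u" using trancl_into_trancl(1) d(1,2) by (rule_tac reach_mono[of d]) auto
      then obtain I where I: "chain_sum \<alpha> e y u I" using reach_chain_sum by blast
      show ?thesis
        using chain_sum.snoc[OF I **(1)] chain_sum.snoc[OF I **(2)] **(3) by (metis add.assoc)
    qed
  qed
  have diff: "\<alpha> z z' = \<beta> z' - \<beta> z"
    if z: "z \<in> chain_class y" "z' \<in> chain_class y" "dist z z' < d" for z z'
  proof -
    obtain I where "chain_sum \<alpha> e y z I" "chain_sum \<alpha> e y z' (I + \<alpha> z z')"
      using step[OF z(1,3)] by blast
    with \<beta> z show ?thesis by fastforce
  qed
  have "continuous_on (chain_class y) \<beta>"
    unfolding continuous_on_iff
  proof (intro ballI allI impI)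
    fix z and \<epsilon> :: real assume z: "z \<in> chain_class y" and "0 < \<epsilon>"
    then obtain \<delta> where \<delta>: "0 < \<delta>" "\<And>z'. dist z z' < \<delta> \<Longrightarrow> \<bar>\<alpha> z z'\<bar> < \<epsilon>"
      using r(3) by metis
    show "\<exists>\<delta>>0. \<forall>z'\<in>chain_class y. dist z' z < \<delta> \<longrightarrow> dist (\<beta> z') (\<beta> z) < \<epsilon>"
    proof (intro exI[of _ "min \<delta> d"] conjI ballI impI)
      fix z' assume "z' \<in> chain_class y" "dist z' z < min \<delta> d"
      with \<delta>(2)[of z'] diff[OF z, of z'] show "dist (\<beta> z') (\<beta> z) < \<epsilon>"
        by (simp add: dist_commute dist_real_def)
    qed (use \<delta>(1) d(1) in simp)
  qed
  moreover have "open {(x :: 'a, z). dist x z < d}"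
    unfolding case_prod_unfold by (intro open_Collect_less continuous_intros)
  ultimately have "primitive_on \<alpha> (chain_class y) \<beta>"
    unfolding primitive_on_def using diff d(1)
    by (intro conjI exI[of _ "{(x, z). dist x z < d}"]) auto
  then show ?thesis by blast
qed

lemma chain_sum_is_chain:
  assumes cover: "\<And>x z. dist x z < e \<Longrightarrow> \<exists>B\<in>\<U>. x \<in> B \<and> z \<in> B"
  shows "chain_sum \<alpha> e x z I \<Longrightarrow> \<exists>k xs. is_chain v \<U> T k xs (\<lambda>_. T) \<and> xs k = z
    \<and> chain_integral \<alpha> v k xs (\<lambda>_. T) = I"
proof (induction rule: chain_sum.induct)
  case (single x z)
  then show ?case
    by (intro exI[of _ 1] exI[of _ "\<lambda>i. if i = 0 then x else z"])
      (auto simp: is_chain_def chain_integral_def jump_def intro: cover)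
next
  case (snoc x u I z)
  then obtain k xs where xs: "is_chain v \<U> T k xs (\<lambda>_. T)" "xs k = u"
      "chain_integral \<alpha> v k xs (\<lambda>_. T) = I"
    by blast
  let ?ys = "xs(Suc k := z)"
  have "is_chain v \<U> T (Suc k) ?ys (\<lambda>_. T)"
    using xs(1,2) snoc.hyps(2) by (auto simp: is_chain_def jump_def less_Suc_eq intro: cover)
  moreover have "chain_integral \<alpha> v (Suc k) ?ys (\<lambda>_. T) =
      I + (curve_integral \<alpha> (v u) 0 T + \<alpha> (v u T) z)"
    using xs(2,3) by (simp add: chain_integral_def)
  ultimately show ?case 
    by (intro exI[of _ "Suc k"] exI[of _ ?ys] conjI) (simp_all del: fun_upd_apply, simp)
qed

end

section \<open>Flow neighbourhoods\<close>

context compact_flow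
begin

text \<open>The times at which the orbits of points of the flow neighbourhood reach \<open>C\<close> need not be bounded,
  so closedness is not automatic. But if a point \<open>x\<close> is not in the flow neighbourhood, then its
  orbit leaves \<open>V\<close> in both time directions, since otherwise it would accumulate at \<open>C\<close>. The
  exit times bound the relevant times of all points near \<open>x\<close>, and with bounded times
  the set is closed by compactness.\<close>

lemma closed_flow_nbhd:
  assumes iso: "isolating_nbhd v U C" and V: "closed V" "V \<subseteq> U" and "0 < r"
  shows "closed (flow_nbhd v C V r)"
proof -
  \<comment> \<open>The part of the flow neighbourhood that needs only times in \<open>[- n, n]\<close>.\<close>
  define K where "K n = {x. \<exists>t\<in>{- n..n}. infdist (v x t) C \<le> r \<and> (\<forall>\<sigma>\<in>{0..1}. v x (\<sigma> * t) \<in> V)}" for n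
  have seg: "(\<forall>\<tau>\<in>closed_segment 0 t. v x \<tau> \<in> V) \<longleftrightarrow> (\<forall>\<sigma>\<in>{0..1}. v x (\<sigma> * t) \<in> V)" for x and t :: real
    by (force simp: closed_segment_def)
  have K_sub: "K n \<subseteq> flow_nbhd v C V r" for n
    unfolding flow_nbhd_def K_def seg by force
  have K_closed: "closed (K n)" for n
  proof -
    let ?P = "{z. infdist (v (fst z) (snd z)) C \<le> r} \<inter>
      (\<Inter>\<sigma>\<in>{0..1}. (\<lambda>z. v (fst z) (\<sigma> * snd z)) -` V)"
    have "closed ?P"
      by (intro closed_Int closed_INT ballI closed_vimage V(1) closed_Collect_le continuous_intros)
    then have "compact ((UNIV \<times> {- n..n}) \<inter> ?P)"
      by (intro compact_Int_closed compact_Times compact_UNIV compact_Icc)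
    then have "compact (fst ` ((UNIV \<times> {- n..n}) \<inter> ?P))"
      by (intro compact_continuous_image continuous_intros)
    moreover have "fst ` ((UNIV \<times> {- n..n}) \<inter> ?P) = K n"
      by (force simp: K_def)
    ultimately show ?thesis by (simp add: compact_imp_closed)
  qed
  \<comment> \<open>An orbit that stays in \<open>V\<close> accumulates at \<open>C\<close>. This is stated for a flow \<open>w\<close> in order to
    cover time reversal.\<close>
  have forward: "x \<in> flow_nbhd w C V r"
    if w: "compact_flow w" "\<And>x. (\<forall>t. w x t \<in> U) \<Longrightarrow> x \<in> C" "\<And>t. 0 \<le> t \<Longrightarrow> w x t \<in> V" for w x
  proof -
    interpret w: compact_flow w by (rule w(1))
    obtain l s where l: "(\<lambda>n. w x (real (s n))) \<longlonglongrightarrow> l" "\<And>t. w l t \<in> V"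
      using w.forward_limit_point[OF V(1) w(3)] by metis
    then have "l \<in> C" using w(2) V(2) by blast
    have "\<forall>\<^sub>F n in sequentially. dist (w x (real (s n))) l < r"
      using l(1) \<open>0 < r\<close> by (rule tendstoD)
    then obtain n where "dist (w x (real (s n))) l < r"
      using eventually_happens by fastforce
    then have "infdist (w x (real (s n))) C \<le> r"
      using infdist_le[OF \<open>l \<in> C\<close>, of "w x (real (s n))"] by simp
    with w(3) show ?thesis
      unfolding flow_nbhd_def
      by (intro CollectI conjI exI[of _ "real (s n)"])
        (use w(3)[of 0] in \<open>auto simp: closed_segment_eq_real_ivl\<close>)
  qed
  have C: "x \<in> C" if "\<forall>t. v x t \<in> U" for x
    using iso that by (simp add: isolating_nbhd_def)
  have in_pos: "x \<in> flow_nbhd v C V r" if "\<And>t. 0 \<le> t \<Longrightarrow> v x t \<in> V" for x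
    by (rule forward) (use compact_flow_axioms C that in auto)
  have in_neg: "x \<in> flow_nbhd v C V r" if "\<And>t. t \<le> 0 \<Longrightarrow> v x t \<in> V" for x
  proof -
    have "x \<in> flow_nbhd (\<lambda>x t. v x (- t)) C V r"
    proof (rule forward[OF reversed])
      fix x assume "\<forall>t. v x (- t) \<in> U"
      then have "v x t \<in> U" for t by (metis minus_minus)
      then show "x \<in> C" using C by blast
    qed (use that in auto)
    then obtain t where "x \<in> V" "infdist (v x (- t)) C \<le> r" "\<forall>\<sigma>\<in>{0..1}. v x (\<sigma> * - t) \<in> V"
      by (force simp: flow_nbhd_def closed_segment_def)
    then show ?thesis unfolding flow_nbhd_def seg by blast
  qed
  have "closure (flow_nbhd v C V r) \<subseteq> flow_nbhd v C V r"
  proof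
    fix x assume x: "x \<in> closure (flow_nbhd v C V r)"
    show "x \<in> flow_nbhd v C V r"
    proof (rule ccontr)
      assume not_in: "x \<notin> flow_nbhd v C V r"
      obtain a where a: "0 \<le> a" "v x a \<notin> V" using in_pos not_in by blast
      obtain b where b: "b \<le> 0" "v x b \<notin> V" using in_neg not_in by blast
      define n where "n = max a (- b)"
      define O' where "O' = (\<lambda>x. v x a) -` (- V) \<inter> (\<lambda>x. v x b) -` (- V)"
      have "open O'"
        unfolding O'_def using V(1)
        by (intro open_Int open_vimage continuous_intros) (auto simp: open_Compl)
      moreover have "x \<in> O'" using a b by (simp add: O'_def)
      ultimately have "x \<in> closure (O' \<inter> flow_nbhd v C V r)"
        using open_Int_closure_subset[of O'] x by blast
      moreover have "O' \<inter> flow_nbhd v C V r \<subseteq> K n"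
      proof
        fix z assume z: "z \<in> O' \<inter> flow_nbhd v C V r"
        then obtain t where t: "infdist (v z t) C \<le> r" "\<forall>\<tau>\<in>closed_segment 0 t. v z \<tau> \<in> V"
          by (auto simp: flow_nbhd_def)
        have "a \<notin> closed_segment 0 t" "b \<notin> closed_segment 0 t"
          using z t(2) by (auto simp: O'_def)
        then have "t \<in> {- n..n}"
          using a(1) b(1) by (auto simp: n_def closed_segment_eq_real_ivl split: if_splits)
        with t show "z \<in> K n" unfolding K_def seg[symmetric] by blast
      qed
      ultimately have "x \<in> K n" using closure_minimal[OF _ K_closed] by blast
      with K_sub not_in show False by blast
    qed
  qed
  then show ?thesis by (simp add: closure_subset_eq)
qed

end

text \<open>The last premise keeps an interval in \<open>Q\<close> around \<open>t\<close> from extending beyond \<open>S\<close>.\<close>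

lemma component_of_times:
  fixes S Q :: "real set"
  assumes "connected S" "t \<in> S" "S \<subseteq> Q"
    and out: "\<And>s. s \<notin> S \<Longrightarrow> \<exists>u\<in>closed_segment s t. u \<notin> Q"
  shows "S \<in> components Q"
proof -
  have "connected_component_set Q t = S"
  proof
    show "S \<subseteq> connected_component_set Q t"
      by (rule connected_component_maximal) (use assms in auto)
    show "connected_component_set Q t \<subseteq> S"
    proof
      fix s assume s: "s \<in> connected_component_set Q t"
      have "t \<in> connected_component_set Q t" using assms(2,3) by auto
      with s have "closed_segment s t \<subseteq> connected_component_set Q t"
        by (meson closed_segment_subset connected_connected_component is_interval_connected_1
            is_interval_convex)
      then have "closed_segment s t \<subseteq> Q" using connected_component_subset by blast
      with out show "s \<in> S" by blast
    qed
  qed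
  moreover have "t \<in> Q" using assms(2,3) by blast
  ultimately show ?thesis unfolding components_def by blast
qed

lemma next_time_outside:
  fixes Q :: "real set"
  assumes "open Q" "t \<in> Q"
  shows "{t..} \<subseteq> Q \<or> (\<exists>b>t. b \<notin> Q \<and> {t..<b} \<subseteq> Q)"
proof (cases "{t..} \<subseteq> Q")
  case False
  let ?S = "- Q \<inter> {t..}"
  have S: "closed ?S" "?S \<noteq> {}" "bdd_below ?S" using False assms(1) by auto
  then have "Inf ?S \<in> ?S" by (intro closed_contains_Inf)
  moreover have "s \<in> Q" if "t \<le> s" "s < Inf ?S" for s
    using cInf_lower[OF _ S(3), of s] that by force
  ultimately show ?thesis using assms(2) by (intro disjI2 exI[of _ "Inf ?S"]) (auto simp: less_le)
qed simp

lemma previous_time_outside: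
  fixes Q :: "real set"
  assumes "open Q" "t \<in> Q"
  shows "{..t} \<subseteq> Q \<or> (\<exists>a<t. a \<notin> Q \<and> {a<..t} \<subseteq> Q)"
proof -
  have "open (uminus ` Q)" "- t \<in> uminus ` Q"
    using assms open_negations[of Q] by auto
  from next_time_outside[OF this] show ?thesis
  proof
    assume "{- t..} \<subseteq> uminus ` Q"
    have "s \<in> Q" if "s \<le> t" for s
      using subsetD[OF \<open>{- t..} \<subseteq> uminus ` Q\<close>, of "- s"] that by auto
    then show ?thesis by auto
  next
    assume "\<exists>b>- t. b \<notin> uminus ` Q \<and> {- t..<b} \<subseteq> uminus ` Q"
    then obtain b where b: "- t < b" "b \<notin> uminus ` Q" "{- t..<b} \<subseteq> uminus ` Q" by blast
    have "s \<in> Q" if "- b < s" "s \<le> t" for s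
      using subsetD[OF b(3), of "- s"] that by auto
    moreover have "- b \<notin> Q" using b(2) by force
    ultimately show ?thesis using b(1) by (intro disjI2 exI[of _ "- b"]) auto
  qed
qed

section \<open>Growth of the primitive along an alpha-flow\<close>

text \<open>The situation to be refuted: an \<open>\<alpha>\<close>-flow, a chain recurrent point \<open>y\<close> that is not fixed, and a
  primitive \<open>\<beta>\<close> of \<open>\<alpha>\<close> on its chain class. The components \<open>C\<close> enter only through the points \<open>p C\<close>
  of which they consist, their flow neighbourhoods \<open>K C\<close>, and the primitives \<open>b C\<close> around these.\<close>

locale alpha_flow_on_chain_class = compact_flow_step +
  fixes \<alpha> :: "'a \<Rightarrow> 'a \<Rightarrow> real"
    and \<C> :: "'i set" and K W :: "'i \<Rightarrow> 'a set" and p :: "'i \<Rightarrow> 'a" and b :: "'i \<Rightarrow> 'a \<Rightarrow> real"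
    and \<rho> \<theta> T0 :: real and y :: 'a and \<beta> :: "'a \<Rightarrow> real" and \<K> :: "'a set"
  defines "\<K> \<equiv> \<Union>C\<in>\<C>. K C"
  assumes finite_\<C>: "finite \<C>" and disjoint: "disjoint_family_on K \<C>"
    and closed_K: "\<And>C. C \<in> \<C> \<Longrightarrow> closed (K C)"
    and fixed_p: "\<And>C. C \<in> \<C> \<Longrightarrow> p C \<in> fixed_points v"
    and isolated_p: "\<And>C x. C \<in> \<C> \<Longrightarrow> (\<And>t. v x t \<in> K C) \<Longrightarrow> x = p C"
    and p_interior: "\<And>C. C \<in> \<C> \<Longrightarrow> p C \<in> interior (K C)"
    and primitive_K: "\<And>C. C \<in> \<C> \<Longrightarrow> primitive_on \<alpha> (W C) (b C)"
    and K_W: "\<And>C. C \<in> \<C> \<Longrightarrow> K C \<subseteq> W C"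
    and osc: "\<And>C x z. C \<in> \<C> \<Longrightarrow> x \<in> K C \<Longrightarrow> z \<in> K C \<Longrightarrow> \<bar>b C z - b C x\<bar> \<le> \<theta> * \<rho>"
    and \<rho>_pos: "0 < \<rho>" and \<theta>_less: "\<theta> < 1" and T0_pos: "0 < T0"
    and short: "\<And>x c d. c < d \<Longrightarrow> (x, {c<..<d}) \<in> Gamma1 v \<K> \<Longrightarrow> \<rho> \<le> curve_integral \<alpha> (v x) c d"
    and long: "\<And>x J c. (x, J) \<in> Gamma2 v \<K> \<union> Gamma3 v \<K> \<Longrightarrow> {c..c + T0} \<subseteq> J \<Longrightarrow>
      \<rho> \<le> curve_integral \<alpha> (v x) c (c + T0)"
    and y_not_fixed: "y \<notin> fixed_points v" and y_recurrent: "y \<leadsto> y"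
    and primitive_\<beta>: "primitive_on \<alpha> (chain_class y) \<beta>"
begin

lemma closed_\<K>: "closed \<K>"
  unfolding \<K>_def using finite_\<C> closed_K by (intro closed_UN) auto

lemma continuous_\<beta>: "continuous_on (chain_class y) \<beta>"
  using primitive_\<beta> by (simp add: primitive_on_def)

lemma compact_chain_class: "compact (chain_class y)"
  using compact_Int_closed[OF compact_UNIV closed_chain_class] by simp

lemma curve_integral_\<beta>:
  assumes "x \<in> chain_class y" "c \<le> d"
  shows "curve_integral \<alpha> (v x) c d = \<beta> (v x d) - \<beta> (v x c)"
  by (rule curve_integral_primitive[OF primitive_\<beta>])
    (use assms chain_class_flow in \<open>auto intro!: continuous_intros\<close>)

text \<open>On orbit segments in the chain class that stay in one flow neighbourhood, both primitives
  compute the integral of \<open>\<alpha>\<close>.\<close>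

lemma \<beta>_diff_eq_b_diff:
  assumes "C \<in> \<C>" "x \<in> chain_class y" "\<And>s. s \<in> closed_segment c d \<Longrightarrow> v x s \<in> K C"
  shows "\<beta> (v x d) - \<beta> (v x c) = b C (v x d) - b C (v x c)"
proof -
  have *: "\<beta> (v x d) - \<beta> (v x c) = b C (v x d) - b C (v x c)"
    if "c \<le> d" "\<And>s. s \<in> {c..d} \<Longrightarrow> v x s \<in> K C" for c d
  proof -
    have "curve_integral \<alpha> (v x) c d = b C (v x d) - b C (v x c)"
      by (rule curve_integral_primitive[OF primitive_K[OF assms(1)]])
        (use that K_W[OF assms(1)] in \<open>auto intro!: continuous_intros\<close>)
    with curve_integral_\<beta>[OF assms(2) that(1)] show ?thesis by simp
  qed
  show ?thesis
  proof (cases "c \<le> d")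
    case True
    then show ?thesis using assms(3) by (intro *) (auto simp: closed_segment_eq_real_ivl)
  next
    case False
    then have "\<beta> (v x c) - \<beta> (v x d) = b C (v x c) - b C (v x d)"
      using assms(3) by (intro *) (auto simp: closed_segment_eq_real_ivl)
    then show ?thesis by simp
  qed
qed

lemma \<beta>_bounded: obtains D where "\<And>z. z \<in> chain_class y \<Longrightarrow> \<bar>\<beta> z\<bar> \<le> D"
proof -
  have "bounded (\<beta> ` chain_class y)"
    by (intro compact_imp_bounded compact_continuous_image continuous_\<beta> compact_chain_class)
  then show ?thesis using that by (auto simp: bounded_iff)
qed

text \<open>Along a piece with unbounded time domain \<open>\<beta>\<close> would grow by \<open>\<rho>\<close> in every time interval of length
  \<open>T0\<close>, but \<open>\<beta>\<close> is bounded on the chain class.\<close>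

lemma no_unbounded_piece:
  assumes x: "x \<in> chain_class y" and J: "(x, J) \<in> Gamma2 v \<K> \<union> Gamma3 v \<K>"
  shows False
proof -
  have piece: "\<beta> (v x c) + \<rho> \<le> \<beta> (v x (c + T0))" if "{c..c + T0} \<subseteq> J" for c
    using long[OF J that] curve_integral_\<beta>[OF x, of c "c + T0"] T0_pos by simp
  have pieces: "\<beta> (v x c) + real n * \<rho> \<le> \<beta> (v x (c + real n * T0))"
    if "{c..c + real n * T0} \<subseteq> J" for c n
    using that
  proof (induction n)
    case (Suc n)
    have "{c..c + real n * T0} \<subseteq> {c..c + real (Suc n) * T0}"
      "{c + real n * T0..c + real n * T0 + T0} \<subseteq> {c..c + real (Suc n) * T0}"
      using T0_pos by (auto simp: algebra_simps add_increasing)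
    then have "{c..c + real n * T0} \<subseteq> J" "{c + real n * T0..c + real n * T0 + T0} \<subseteq> J"
      using Suc.prems by blast+
    from Suc.IH[OF this(1)] piece[OF this(2)] show ?case by (simp add: algebra_simps)
  qed simp
  obtain D where D: "\<And>z. z \<in> chain_class y \<Longrightarrow> \<bar>\<beta> z\<bar> \<le> D" by (rule \<beta>_bounded) blast
  have bnd: "real n * \<rho> \<le> 2 * D" if "{c..c + real n * T0} \<subseteq> J" for c n
    using pieces[OF that] D[OF chain_class_flow[OF x, of c]]
      D[OF chain_class_flow[OF x, of "c + real n * T0"]] by linarith
  obtain n where n: "2 * D < real n * \<rho>" using reals_Archimedean3[OF \<rho>_pos] by blast
  have "\<exists>c. {c..c + real n * T0} \<subseteq> J"
  proof -
    consider a where "J = {a<..}" | a where "J = {..<a}" | "J = UNIV"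
      using J by (auto simp: Gamma2_def Gamma3_def)
    then show ?thesis
    proof cases
      case (1 a)
      then show ?thesis by (intro exI[of _ "a + 1"]) auto
    next
      case (2 a)
      then show ?thesis by (intro exI[of _ "a - 1 - real n * T0"]) auto
    qed simp
  qed
  with bnd n show False by fastforce
qed

text \<open>Boundedness of \<open>\<beta>\<close> leaves only pieces with bounded time domain, and these raise \<open>\<beta>\<close> by \<open>\<rho>\<close>.\<close>

lemma bounded_piece:
  assumes x: "x \<in> chain_class y" and t: "v x t \<notin> \<K>"
  obtains c d where "c < t" "t < d" "v x c \<in> \<K>" "v x d \<in> \<K>" "\<And>s. c < s \<Longrightarrow> s < d \<Longrightarrow> v x s \<notin> \<K>"
    "\<beta> (v x c) + \<rho> \<le> \<beta> (v x d)"
proof -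
  define Q where "Q = {t. v x t \<notin> \<K>}"
  have "open ((\<lambda>t. v x t) -` (- \<K>))"
    using closed_\<K> by (intro open_vimage continuous_intros) (simp add: open_Compl)
  then have Q: "open Q" "t \<in> Q" using t by (auto simp: Q_def vimage_def)
  have no: "S \<notin> components Q" if "(\<exists>a. S = {a<..} \<or> S = {..<a}) \<or> S = UNIV" for S
    using no_unbounded_piece[OF x, of S] that
    by (auto simp: Gamma2_def Gamma3_def max_pieces_def Q_def)
  note up = next_time_outside[OF Q] and down = previous_time_outside[OF Q]
  obtain d where d: "t < d" "d \<notin> Q" "{t..<d} \<subseteq> Q"
  proof -
    have False if t_up: "{t..} \<subseteq> Q"
      using down
    proof (elim disjE exE conjE)
      assume "{..t} \<subseteq> Q"
      with t_up have "UNIV \<in> components Q"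
        by (intro component_of_times[of _ t]) (auto simp: subset_iff, metis linear)
      with no show False by blast
    next
      fix a assume a: "a < t" "a \<notin> Q" "{a<..t} \<subseteq> Q"
      have "{a<..} \<in> components Q"
      proof (rule component_of_times[of _ t])
        fix s assume "s \<notin> {a<..}"
        then show "\<exists>u\<in>closed_segment s t. u \<notin> Q"
          using a by (intro bexI[of _ a]) (auto simp: closed_segment_eq_real_ivl)
      next
        show "{a<..} \<subseteq> Q" using a(3) t_up by (auto simp: subset_iff) (metis linear)
      qed (use a in auto)
      with no show False by blast
    qed
    with up that show ?thesis by blast
  qed
  obtain c where c: "c < t" "c \<notin> Q" "{c<..t} \<subseteq> Q"
  proof -
    have False if t_down: "{..t} \<subseteq> Q"
    proof -
      have "{..<d} \<in> components Q"
      proof (rule component_of_times[of _ t])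
        fix s assume "s \<notin> {..<d}"
        then show "\<exists>u\<in>closed_segment s t. u \<notin> Q"
          using d by (intro bexI[of _ d]) (auto simp: closed_segment_eq_real_ivl)
      next
        show "{..<d} \<subseteq> Q" using d(3) t_down by (auto simp: subset_iff) (metis linear)
      qed (use d in auto)
      with no show False by blast
    qed
    with down that show ?thesis by blast
  qed
  have "{c<..<d} \<in> components Q"
  proof (rule component_of_times[of _ t])
    fix s assume "s \<notin> {c<..<d}"
    then have "s \<le> c \<or> d \<le> s" by auto
    then show "\<exists>u\<in>closed_segment s t. u \<notin> Q"
    proof
      assume "s \<le> c"
      then show ?thesis using c by (intro bexI[of _ c]) (auto simp: closed_segment_eq_real_ivl)
    next
      assume "d \<le> s"
      then show ?thesis using d by (intro bexI[of _ d]) (auto simp: closed_segment_eq_real_ivl)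
    qed
  next
    show "{c<..<d} \<subseteq> Q" using c(3) d(3) by (auto simp: subset_iff) (metis linear not_less)
  qed (use c d in auto)
  then have "(x, {c<..<d}) \<in> Gamma1 v \<K>"
    using less_trans[OF c(1) d(1)] unfolding Gamma1_def max_pieces_def Q_def by blast
  then have "\<beta> (v x c) + \<rho> \<le> \<beta> (v x d)"
    using short[of c d x] curve_integral_\<beta>[OF x, of c d] c(1) d(1) by simp
  moreover have "v x s \<notin> \<K>" if "c < s" "s < d" for s
    using subsetD[OF c(3), of s] subsetD[OF d(3), of s] that
    by (cases "s \<le> t") (auto simp: Q_def)
  ultimately show ?thesis using c d that[of c d] by (auto simp: Q_def)
qed

text \<open>There may be no piece that starts exactly at \<open>u\<close>, since pieces may accumulate there. Continuity of \<open>\<beta>\<close> makes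
  up for it: a piece starting shortly after \<open>u\<close> starts with almost the value of \<open>\<beta>\<close> at \<open>u\<close>, which
  costs an arbitrarily small \<open>\<sigma>\<close>.\<close>

lemma \<beta>_gain_near_exit:
  assumes u: "u \<in> chain_class y" "u \<in> \<K>" and "0 < \<sigma>"
    and exits: "\<And>\<eta>. 0 < \<eta> \<Longrightarrow> \<exists>t. 0 < t \<and> t < \<eta> \<and> v u t \<notin> \<K>"
  shows "\<exists>z\<in>chain_class y \<inter> \<K>. \<beta> u + \<rho> - \<sigma> \<le> \<beta> z"
proof -
  have "continuous_on UNIV (\<lambda>t. \<beta> (v u t))"
    by (rule continuous_on_compose2[OF continuous_\<beta>])
      (auto intro!: continuous_intros chain_class_flow u(1))
  then obtain \<eta> where \<eta>: "0 < \<eta>" "\<And>t. dist t 0 < \<eta> \<Longrightarrow> dist (\<beta> (v u t)) (\<beta> (v u 0)) < \<sigma>"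
    using \<open>0 < \<sigma>\<close> unfolding continuous_on_iff by (metis UNIV_I)
  obtain t where t: "0 < t" "t < \<eta>" "v u t \<notin> \<K>" using exits[OF \<eta>(1)] by blast
  obtain c d where cd: "c < t" "t < d" "v u c \<in> \<K>" "v u d \<in> \<K>" "\<beta> (v u c) + \<rho> \<le> \<beta> (v u d)"
    and gap: "\<And>s. c < s \<Longrightarrow> s < d \<Longrightarrow> v u s \<notin> \<K>"
    using bounded_piece[OF u(1) t(3)] by metis
  have "0 \<le> c" using gap[of 0] u(2) cd t(1) by (auto simp: not_less[symmetric])
  then have "\<beta> u - \<sigma> \<le> \<beta> (v u c)"
    using \<eta>(2)[of c] cd(1) t(2) by (simp add: dist_real_def abs_less_iff)
  with cd show ?thesis
    by (intro bexI[of _ "v u d"]) (auto intro: chain_class_flow u(1))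
qed

text \<open>Take \<open>u\<close> at the infimum of the times outside \<open>K C\<close>. Shortly after this time
  the orbit is also away from the other flow neighbourhoods, which are closed and disjoint
  from \<open>K C\<close>.\<close>

lemma exit_K:
  assumes C: "C \<in> \<C>" and w: "w \<in> chain_class y" "w \<in> K C" and t: "0 \<le> t" "v w t \<notin> K C"
  obtains u where "u \<in> chain_class y" "u \<in> K C" "\<beta> u - \<beta> w = b C u - b C w"
    "\<And>\<eta>. 0 < \<eta> \<Longrightarrow> \<exists>t. 0 < t \<and> t < \<eta> \<and> v u t \<notin> \<K>"
proof -
  define S where "S = {t. 0 \<le> t \<and> v w t \<notin> K C}"
  define e where "e = Inf S"
  have S: "S \<noteq> {}" "bdd_below S" using t by (auto simp: S_def intro: bdd_belowI[of _ 0])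
  have e0: "0 \<le> e" unfolding e_def by (rule cInf_greatest[OF S(1)]) (simp add: S_def)
  have stay: "v w s \<in> K C" if "0 \<le> s" "s < e" for s
    using cInf_lower[OF _ S(2), of s] that by (force simp: S_def e_def)
  have eK: "v w e \<in> K C"
  proof (cases "e = 0")
    case False
    have "e \<in> closure {0..<e}" using e0 False by simp
    moreover have "{0..<e} \<subseteq> (\<lambda>s. v w s) -` K C" using stay by auto
    moreover have "closed ((\<lambda>s. v w s) -` K C)"
      by (intro closed_vimage closed_K C continuous_intros)
    ultimately show ?thesis using closure_minimal by blast
  qed (use w in simp)
  have diff: "\<beta> (v w e) - \<beta> w = b C (v w e) - b C w"
    using \<beta>_diff_eq_b_diff[OF C w(1), of 0 e] stay eK e0
    by (force simp: closed_segment_eq_real_ivl less_le)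
  have exits: "\<exists>t. 0 < t \<and> t < \<eta> \<and> v (v w e) t \<notin> \<K>" if \<eta>: "0 < \<eta>" for \<eta>
  proof -
    have "closed (\<Union>C'\<in>\<C> - {C}. K C')"
      by (rule closed_UN) (use finite_\<C> closed_K in auto)
    then have "open ((\<lambda>t. v (v w e) t) -` (- (\<Union>C'\<in>\<C> - {C}. K C')))" (is "open ?O")
      by (rule open_vimage[OF open_Compl]) (intro continuous_intros)
    moreover have "v w e \<notin> (\<Union>C'\<in>\<C> - {C}. K C')"
      using disjoint C eK unfolding disjoint_family_on_def by blast
    then have "0 \<in> ?O" by simp
    ultimately obtain \<epsilon> where \<epsilon>: "0 < \<epsilon>" "ball 0 \<epsilon> \<subseteq> ?O"
      by (rule openE)
    obtain s where s: "s \<in> S" "s < e + min \<eta> \<epsilon>"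
      using cInf_lessD[OF S(1), of "e + min \<eta> \<epsilon>"] \<eta> \<epsilon>(1) by (auto simp: e_def)
    have "e \<le> s" using cInf_lower[OF s(1) S(2)] by (simp add: e_def)
    moreover have "s \<noteq> e" using s(1) eK by (auto simp: S_def)
    ultimately have "0 < s - e" by simp
    have "s - e \<in> ball 0 \<epsilon>" using \<open>0 < s - e\<close> s(2) by (simp add: dist_real_def)
    with \<epsilon>(2) have "v w s \<notin> (\<Union>C'\<in>\<C> - {C}. K C')" by fastforce
    moreover have "v w s \<notin> K C" using s(1) by (simp add: S_def)
    ultimately have "v w s \<notin> \<K>" by (auto simp: \<K>_def)
    with \<open>0 < s - e\<close> s(2) show ?thesis by (intro exI[of _ "s - e"]) auto
  qed
  show ?thesis by (rule that[OF chain_class_flow[OF w(1)] eK diff exits])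
qed

text \<open>The sequence \<open>\<sigma>\<close> may tend to infinity in either direction. Continuity of both primitives at
  \<open>p C\<close> extends \<open>\<beta>_diff_eq_b_diff\<close> to an infinite orbit segment.\<close>

lemma converge_to_p:
  assumes C: "C \<in> \<C>" and z: "z \<in> chain_class y" and lim: "(\<lambda>n. v z (\<sigma> n)) \<longlonglongrightarrow> p C"
    and stay: "\<And>n s. s \<in> closed_segment 0 (\<sigma> n) \<Longrightarrow> v z s \<in> K C"
  shows "p C \<in> chain_class y" "\<beta> (p C) - \<beta> z = b C (p C) - b C z"
proof -
  show p: "p C \<in> chain_class y"
    using closed_sequentially[OF closed_chain_class _ lim] chain_class_flow[OF z] by blast
  have "(\<lambda>n. \<beta> (v z (\<sigma> n)) - \<beta> z) \<longlonglongrightarrow> \<beta> (p C) - \<beta> z"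
    by (intro tendsto_diff tendsto_const continuous_on_tendsto_compose[OF continuous_\<beta> lim p])
      (simp add: chain_class_flow[OF z])
  moreover have "p C \<in> K C" using p_interior[OF C] interior_subset by blast
  then have "p C \<in> W C" using K_W[OF C] by blast
  have "v z (\<sigma> n) \<in> W C" for n
    using stay[of "\<sigma> n" n] K_W[OF C] by auto
  with \<open>p C \<in> W C\<close> have "(\<lambda>n. b C (v z (\<sigma> n)) - b C z) \<longlonglongrightarrow> b C (p C) - b C z"
    using primitive_K[OF C]
    by (intro tendsto_diff tendsto_const continuous_on_tendsto_compose[OF _ lim, of "W C"])
      (auto simp: primitive_on_def)
  moreover have "\<beta> (v z (\<sigma> n)) - \<beta> z = b C (v z (\<sigma> n)) - b C z" for n
    using \<beta>_diff_eq_b_diff[OF C z, of 0 "\<sigma> n"] stay by simp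
  ultimately show "\<beta> (p C) - \<beta> z = b C (p C) - b C z"
    by (simp add: LIMSEQ_unique)
qed

text \<open>If the orbit of \<open>z\<close> does not leave \<open>K C\<close>, then it is continued through \<open>p C\<close>
  by an orbit of the chain class that emanates from \<open>p C\<close>. Here it matters that the
  component \<open>C\<close> is a single point: both orbits tend to the same point of the class.\<close>

lemma continue_from_K:
  assumes C: "C \<in> \<C>" and z: "z \<in> chain_class y" "z \<in> K C"
  obtains u where "u \<in> chain_class y" "u \<in> K C" "\<beta> u - \<beta> z = b C u - b C z"
    "\<And>\<eta>. 0 < \<eta> \<Longrightarrow> \<exists>t. 0 < t \<and> t < \<eta> \<and> v u t \<notin> \<K>"
proof (cases "\<exists>t\<ge>0. v z t \<notin> K C")
  case True
  with exit_K[OF C z] that show ?thesis by metis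
next
  case False
  then have stay: "v z t \<in> K C" if "0 \<le> t" for t using that by blast
  obtain l r where l: "(\<lambda>n. v z (real (r n))) \<longlonglongrightarrow> l" "\<And>t. v l t \<in> K C"
    using forward_limit_point[OF closed_K[OF C] stay] by metis
  have "l = p C" using isolated_p[OF C l(2)] .
  with l(1) have "(\<lambda>n. v z (real (r n))) \<longlonglongrightarrow> p C" by simp
  from converge_to_p[OF C z(1) this] stay
  have p: "p C \<in> chain_class y" and pz: "\<beta> (p C) - \<beta> z = b C (p C) - b C z"
    by (auto simp: closed_segment_eq_real_ivl)
  have "y \<noteq> p C" using y_not_fixed fixed_p[OF C] by auto
  obtain w where w: "w \<in> chain_class y" "w \<noteq> p C" "\<And>t. t \<le> 0 \<Longrightarrow> v w t \<in> interior (K C)"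
    using exists_unstable_point_in_chain_class[OF p fixed_p[OF C] \<open>y \<noteq> p C\<close> y_recurrent
      open_interior p_interior[OF C]] by blast
  then have w_stay: "v w t \<in> K C" if "t \<le> 0" for t using that interior_subset by blast
  have wK: "w \<in> K C" using w_stay[of 0] by simp
  have "\<And>t. 0 \<le> t \<Longrightarrow> v w (- t) \<in> K C" using w_stay by simp
  from compact_flow.forward_limit_point[OF reversed closed_K[OF C] this]
  obtain l r where l: "(\<lambda>n. v w (- real (r n))) \<longlonglongrightarrow> l" "\<And>t. v l (- t) \<in> K C"
    by metis
  have "v l t \<in> K C" for t using l(2)[of "- t"] by simp
  then have "l = p C" by (rule isolated_p[OF C])
  with l(1) have "(\<lambda>n. v w (- real (r n))) \<longlonglongrightarrow> p C" by simp
  moreover have "v w s \<in> K C" if "s \<in> closed_segment 0 (- real (r n))" for n s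
    using that by (intro w_stay) (auto simp: closed_segment_eq_real_ivl split: if_splits)
  ultimately have pw: "\<beta> (p C) - \<beta> w = b C (p C) - b C w"
    by (rule converge_to_p(2)[OF C w(1)])
  have "\<exists>t. v w t \<notin> K C" using isolated_p[OF C] w(2) by blast
  then obtain t where t: "0 \<le> t" "v w t \<notin> K C" using w_stay by (meson linear)
  from exit_K[OF C w(1) wK t] obtain u where u: "u \<in> chain_class y" "u \<in> K C"
    "\<beta> u - \<beta> w = b C u - b C w" "\<And>\<eta>. 0 < \<eta> \<Longrightarrow> \<exists>t. 0 < t \<and> t < \<eta> \<and> v u t \<notin> \<K>"
    by metis
  have "\<beta> u - \<beta> z = b C u - b C z" using pz pw u(3) by linarith
  from that[OF u(1,2) this u(4)] show ?thesis .
qed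

text \<open>From a maximum of \<open>\<beta>\<close> on the part of the chain class in the flow neighbourhoods one reaches
  another point of this set at which \<open>\<beta>\<close> is larger by almost \<open>\<rho> - \<theta> \<rho> > 0\<close>.\<close>

lemma no_recurrent_nonfixed_point: False
proof -
  let ?S = "chain_class y \<inter> \<K>"
  have y: "y \<in> chain_class y" using y_recurrent by (simp add: chain_class_def)
  have "?S \<noteq> {}"
  proof (cases "y \<in> \<K>")
    case False
    then obtain c where "v y c \<in> \<K>" using bounded_piece[OF y, of 0] by auto
    then show ?thesis using chain_class_flow[OF y] by blast
  qed (use y in blast)
  moreover have "compact ?S" by (intro compact_Int_closed compact_chain_class closed_\<K>)
  ultimately obtain z where z: "z \<in> ?S" "\<And>z'. z' \<in> ?S \<Longrightarrow> \<beta> z' \<le> \<beta> z"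
    using continuous_attains_sup[of ?S \<beta>] continuous_on_subset[OF continuous_\<beta>] by blast
  then obtain C where C: "C \<in> \<C>" "z \<in> K C" by (auto simp: \<K>_def)
  obtain u where u: "u \<in> chain_class y" "u \<in> K C" "\<beta> u - \<beta> z = b C u - b C z"
    "\<And>\<eta>. 0 < \<eta> \<Longrightarrow> \<exists>t. 0 < t \<and> t < \<eta> \<and> v u t \<notin> \<K>"
    using continue_from_K[OF C(1) _ C(2)] z(1) by (metis IntD1)
  have "- (\<theta> * \<rho>) \<le> \<beta> u - \<beta> z" using osc[OF C u(2)] u(3) by simp
  \<comment> \<open>Half of the guaranteed gain, so that a gain remains after the loss of \<open>\<sigma>\<close>.\<close>
  moreover define \<sigma> where "\<sigma> = (1 - \<theta>) * \<rho> / 2"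
  have "0 < \<sigma>" using \<theta>_less \<rho>_pos by (simp add: \<sigma>_def)
  moreover obtain z' where "z' \<in> ?S" "\<beta> u + \<rho> - \<sigma> \<le> \<beta> z'"
    using \<beta>_gain_near_exit[OF u(1) _ \<open>0 < \<sigma>\<close> u(4)] u(2) C(1) by (auto simp: \<K>_def)
  moreover have "\<rho> - \<theta> * \<rho> = 2 * \<sigma>" by (simp add: \<sigma>_def algebra_simps)
  ultimately show False using z(2)[of z'] by linarith
qed

end

context compact_flow_step
begin

lemma alpha_flow_chain_recurrent_imp_fixed:
  assumes "alpha_flow v \<alpha>" and y: "y \<leadsto> y" and \<beta>: "primitive_on \<alpha> (chain_class y) \<beta>"
  shows "y \<in> fixed_points v"
proof (rule ccontr)
  assume not_fixed: "y \<notin> fixed_points v"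
  obtain A where "generalized_alpha_flow v \<alpha> A" and points: "\<forall>C\<in>components A. \<exists>p. C = {p}"
    using assms(1) by (auto simp: alpha_flow_def)
  then obtain U V K r T\<^sub>0 \<rho> \<theta> where
    fin: "finite (components A)"
    and pos: "r > 0" "T\<^sub>0 > 0" "\<rho> > 0" "\<theta> < 1"
    and nbhd: "\<forall>C\<in>components A. isolating_nbhd v (U C) C \<and> closed (V C) \<and>
      C \<subseteq> interior (V C) \<and> V C \<subseteq> U C \<and> K C = flow_nbhd v C (V C) r"
    and disj: "disjoint_family_on K (components A)"
    and prim: "\<forall>C\<in>components A. class_zero_on \<alpha> C \<and> (\<exists>W \<beta>. open W \<and> K C \<subseteq> W \<and>
      primitive_on \<alpha> W \<beta> \<and> (\<forall>x\<in>K C. \<forall>y\<in>K C. \<bar>\<beta> y - \<beta> x\<bar> \<le> \<theta> * \<rho>))"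
    and short: "\<forall>x a b. a < b \<longrightarrow> (x, {a<..<b}) \<in> Gamma1 v (\<Union>C\<in>components A. K C) \<longrightarrow>
      \<rho> \<le> curve_integral \<alpha> (v x) a b"
    and long: "\<forall>x J c. (x, J) \<in> Gamma2 v (\<Union>C\<in>components A. K C) \<union>
      Gamma3 v (\<Union>C\<in>components A. K C) \<longrightarrow> {c..c + T\<^sub>0} \<subseteq> J \<longrightarrow>
      \<rho> \<le> curve_integral \<alpha> (v x) c (c + T\<^sub>0)"
    unfolding generalized_alpha_flow_def by (elim conjE exE) (rule that)
  obtain p where p: "\<And>C. C \<in> components A \<Longrightarrow> C = {p C}" using points by metis
  obtain W b where Wb: "\<And>C. C \<in> components A \<Longrightarrow> K C \<subseteq> W C \<and> primitive_on \<alpha> (W C) (b C) \<and>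
      (\<forall>x\<in>K C. \<forall>y\<in>K C. \<bar>b C y - b C x\<bar> \<le> \<theta> * \<rho>)"
    using prim by metis
  \<comment> \<open>\<open>{p C}\<close> is the largest invariant subset of \<open>U C\<close>; in particular \<open>p C\<close> is fixed.\<close>
  have inv: "x = p C" if C: "C \<in> components A" and "\<And>t. v x t \<in> U C" for C x
    using bspec[OF nbhd C] p[OF C] that(2) unfolding isolating_nbhd_def by blast
  have pU: "v (p C) t \<in> U C" if C: "C \<in> components A" for C t
    using bspec[OF nbhd C] p[OF C] unfolding isolating_nbhd_def by blast
  have K_U: "K C \<subseteq> U C" if "C \<in> components A" for C
    using bspec[OF nbhd that] by (auto simp: flow_nbhd_def)
  interpret alpha_flow_on_chain_class v T \<alpha> "components A" K W p b \<rho> \<theta> T\<^sub>0 y \<beta>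
    "\<Union>C\<in>components A. K C"
  proof unfold_locales
    fix C assume C: "C \<in> components A"
    show "closed (K C)" using bspec[OF nbhd C] closed_flow_nbhd pos(1) by metis
    show "p C \<in> fixed_points v"
      unfolding fixed_points_def using inv[OF C, of "v (p C) t" for t] pU[OF C] by auto
    show "x = p C" if "\<And>t. v x t \<in> K C" for x
      using inv[OF C] K_U[OF C] that by blast
    have "ball (p C) r \<inter> interior (V C) \<subseteq> K C"
    proof
      fix x assume x: "x \<in> ball (p C) r \<inter> interior (V C)"
      then have "x \<in> V C" "dist x (p C) \<le> r" using interior_subset by (auto simp: dist_commute)
      moreover have "infdist x C = dist x (p C)" by (subst p[OF C]) simp
      ultimately have "x \<in> flow_nbhd v C (V C) r"
        unfolding flow_nbhd_def by (intro CollectI conjI exI[of _ 0]) auto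
      then show "x \<in> K C" using bspec[OF nbhd C] by simp
    qed
    moreover have "p C \<in> ball (p C) r \<inter> interior (V C)"
      using bspec[OF nbhd C] p[OF C] pos(1) by auto
    ultimately show "p C \<in> interior (K C)"
      by (meson interiorI open_Int open_ball open_interior)
  qed (use fin disj Wb pos short long not_fixed y \<beta> in blast)+
  show False by (rule no_recurrent_nonfixed_point)
qed

end

theorem theorem3p4:
  fixes v :: "'a::metric_space \<Rightarrow> real \<Rightarrow> 'a"
    and \<alpha> :: "'a \<Rightarrow> 'a \<Rightarrow> real"
    and s :: "nat \<Rightarrow> real"
    and \<U> :: "nat \<Rightarrow> 'a set set"
    and M T :: real
  assumes "compact (UNIV :: 'a set)"
    and "is_flow v"
    and "finite (components (fixed_points v))"
    and "continuous_cocycle \<alpha>"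
    and "\<not> trivial_cocycle \<alpha>"
    and "alpha_flow v \<alpha>"
    and "\<not> gradient_like v"
    and "\<And>i. s i > 0"
    and "s \<longlonglongrightarrow> 0"
    and "\<And>i. ball_covering (s i) (\<U> i)"
    and "M > 0"
    and "T > 0"
  shows "\<forall>i. \<exists>k x t. is_chain v (\<U> i) T k x t \<and> \<bar>chain_integral \<alpha> v k x t\<bar> \<ge> M"
proof
  fix i
  interpret compact_flow_step v T
    by unfold_locales (use assms in auto)
  show "\<exists>k x t. is_chain v (\<U> i) T k x t \<and> \<bar>chain_integral \<alpha> v k x t\<bar> \<ge> M"
  proof (rule ccontr)
    assume contr: "\<not> ?thesis"
    \<comment> \<open>\<open>e\<close> is going to be a Lebesgue number of the covering.\<close>
    have "(UNIV :: 'a set) \<subseteq> \<Union>(\<U> i)" "\<And>B. B \<in> \<U> i \<Longrightarrow> open B"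
      using assms(10)[of i] by (auto simp: ball_covering_def)
    then obtain e where e: "0 < e" "\<And>x. \<exists>B\<in>\<U> i. ball x e \<subseteq> B"
      by (rule Heine_Borel_lemma[OF compact_UNIV, of "\<U> i"]) auto
    have cover: "\<exists>B\<in>\<U> i. x \<in> B \<and> z \<in> B" if "dist x z < e" for x z
    proof -
      obtain B where "B \<in> \<U> i" "ball x e \<subseteq> B" using e(2) by blast
      then show ?thesis using that e(1) by (intro bexI[of _ B]) auto
    qed
    \<comment> \<open>All times of these chains are equal to \<open>T\<close>, so they are among the chains in the claim.\<close>
    have bnd: "\<bar>I\<bar> < M" if "chain_sum \<alpha> e x z I" for x z I
    proof -
      from cover that obtain k xs where "is_chain v (\<U> i) T k xs (\<lambda>_. T)"
          "chain_integral \<alpha> v k xs (\<lambda>_. T) = I"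
        using chain_sum_is_chain[where e = e and \<U> = "\<U> i"] by metis
      with contr show ?thesis by (metis not_less)
    qed
    have "gradient_like v"
    proof (rule gradient_like_if_no_chain_recurrence)
      fix y assume "y \<notin> fixed_points v"
      moreover have "\<exists>\<beta>. primitive_on \<alpha> (chain_class y) \<beta>"
        using assms(4) e(1) bnd by (rule primitive_on_chain_class)
      ultimately show "\<not> y \<leadsto> y"
        using alpha_flow_chain_recurrent_imp_fixed[OF assms(6)] by blast
    qed
    with assms(7) show False by blast
  qed
qed

end
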